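(* Let $G$ be a layer-complete directed graph with nonempty layers $0,\dots,k$ ($k\ge1$), with the plane-induced ribbon structure described in the context and basis $(x_{0,0},x_{0,0}x_{1,s_1})$. Then the Jaeger trees of $G$ are exactly the non-crossing comb-trees.
   Context: A directed graph is an orientation of a finite graph without loops and multiple edges; $\overrightarrow{th}$ denotes an edge with tail $t$ and head $h$, and $xy$ an edge whose orientation is not specified. Connectedness, cycles and spanning trees are meant in the underlying undirected graph. A directed graph is semi-balanced if each of its cycles has the same number of edges going in the two directions; a layering is a function $l:V(G)\to\mathbf{Z}$ with $l(h)-l(t)=1$ for each edge $\overrightarrow{th}$. A layer-complete directed graph is a connected semi-balanced graph $G$ with a layering $l$ such that for each $i\in\mathbf{Z}$ with $l^{-1}(i)\ne\varnothing$ and $l^{-1}(i+1)\neq\varnothing$, there is a complete bipartite subgraph between $l^{-1}(i)$ and $l^{-1}(i+1)$, with all edges oriented from $l^{-1}(i)$ to $l^{-1}(i+1)$. Suppose the nonempty layers are $l^{-1}(0),\dots,l^{-1}(k)$, and denote $l^{-1}(i)=\{x_{i,0},\dots,x_{i,s_i}\}$. Draw $x_{i,0},\dots,x_{i,s_i}$ in this order from left to right on the horizontal line with second coordinate $i$, and draw all edges as straight line segments. The ribbon structure is the one induced by the positive (counterclockwise) orientation of the plane: around $x_{i,j}$ the cyclic order is $x_{i+1,s_{i+1}},\dots,x_{i+1,0}$ (edges going up, from right to left) followed by $x_{i-1,0},\dots,x_{i-1,s_{i-1}}$ (edges going down, from left to right). A non-crossing tree of a complete bipartite graph drawn between two horizontal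 lines is a spanning tree whose edges do not cross each other in the drawing. A spanning tree $T$ of $G$ is a non-crossing comb-tree if for each layer $0\le i\le k$ there is a partition $l^{-1}(i)-\{x_{i,0}\}=D_i\sqcup U_i$, with $D_0=\varnothing$ and $U_k=\varnothing$, such that $T=T_1\cup\dots\cup T_k$ where $T_i$ is a non-crossing tree of the complete bipartite graph with vertex classes $\{x_{i-1,0}\}\cup U_{i-1}$ and $\{x_{i,0}\}\cup D_i$. In a graph with a ribbon structure (a cyclic permutation of the incident edges at each vertex), $xy^+$ denotes the edge following $xy$ at $x$. Given a basis $(b_0,b_0b_1)$ (a vertex and an incident edge), the tour of a spanning tree $T$ is the sequence of node-edge pairs starting with $(b_0,b_0b_1)$ such that if the current pair is $(x,xy)$ and $xy\notin T$ then the next pair is $(x,xy^+)$, while if $xy\in T$ then the next pair is $(y,yx^+)$; it stops right before $(b_0,b_0b_1)$ would become current again. A spanning tree $T$ is a Jaeger tree if for each edge $\overrightarrow{th}\notin T$ the pair $(t,th)$ precedes $(h,th)$ in the tour of $T$. *)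

theory Defs
  imports
    "HOL-Analysis.Analysis"
    "HOL-Combinatorics.Cycles"
    "Graph_Theory.Graph_Theory"
begin

text \<open>
  The pair \<open>(t, h)\<close> in \<open>parcs G\<close> is the edge with tail \<open>t\<close> and head \<open>h\<close>.
  An orientation of a simple graph never contains both \<open>(t, h)\<close> and \<open>(h, t)\<close>.
\<close>

definition oriented_graph :: "'a pair_pre_digraph \<Rightarrow> bool" where
  "oriented_graph G \<longleftrightarrow> pair_digraph G \<and> (\<forall>(t, h) \<in> parcs G. (h, t) \<notin> parcs G)"

text \<open>
  A cycle of the underlying undirected graph, as a list of arcs of the symmetrised graph.
  A library cycle of length 2 there just traverses one edge back and forth.
  The library predicates \<open>forest\<close> and \<open>tree\<close> are not usable here: they refer
  to directed cycles, which a semi-balanced graph never has.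
\<close>

definition und_cycle :: "'a pair_pre_digraph \<Rightarrow> ('a \<times> 'a) list \<Rightarrow> bool" where
  "und_cycle G p \<longleftrightarrow>
     pre_digraph.cycle (with_proj (mk_symmetric (with_proj G))) p \<and> 3 \<le> length p"

definition und_tree :: "'a pair_pre_digraph \<Rightarrow> bool" where
  "und_tree G \<longleftrightarrow> Digraph_Component.connected (with_proj G) \<and> \<not> (\<exists>p. und_cycle G p)"

definition is_spanning_tree :: "'a pair_pre_digraph \<Rightarrow> ('a \<times> 'a) set \<Rightarrow> bool" where
  "is_spanning_tree G T \<longleftrightarrow>
     T \<subseteq> parcs G \<and> und_tree \<lparr>pverts = pverts G, parcs = T\<rparr>"

definition semi_balanced :: "'a pair_pre_digraph \<Rightarrow> bool" where
  "semi_balanced G \<longleftrightarrow>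
     (\<forall>p. und_cycle G p \<longrightarrow>
        length (filter (\<lambda>(u, v). (u, v) \<in> parcs G) p) =
        length (filter (\<lambda>(u, v). (v, u) \<in> parcs G) p))"

definition layering :: "'a pair_pre_digraph \<Rightarrow> ('a \<Rightarrow> int) \<Rightarrow> bool" where
  "layering G l \<longleftrightarrow> (\<forall>(t, h) \<in> parcs G. l h - l t = 1)"

definition layer :: "'a pair_pre_digraph \<Rightarrow> ('a \<Rightarrow> int) \<Rightarrow> int \<Rightarrow> 'a set" where
  "layer G l i = {v \<in> pverts G. l v = i}"

definition layer_complete :: "'a pair_pre_digraph \<Rightarrow> ('a \<Rightarrow> int) \<Rightarrow> bool" where
  "layer_complete G l \<longleftrightarrow>
     oriented_graph G \<and> Digraph_Component.connected (with_proj G) \<and>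
     semi_balanced G \<and> layering G l \<and>
     (\<forall>i. layer G l i \<noteq> {} \<and> layer G l (i + 1) \<noteq> {} \<longrightarrow>
        layer G l i \<times> layer G l (i + 1) \<subseteq> parcs G)"

text \<open>
  In the following, \<open>x i 0, \<dots>, x i (s i)\<close> are the vertices of layer \<open>i\<close> from left to right,
  and \<open>pos\<close> assigns to each vertex its point in the plane.
\<close>

definition layer_enumeration ::
  "'a pair_pre_digraph \<Rightarrow> ('a \<Rightarrow> int) \<Rightarrow> nat \<Rightarrow> (nat \<Rightarrow> nat) \<Rightarrow> (nat \<Rightarrow> nat \<Rightarrow> 'a) \<Rightarrow> bool" where
  "layer_enumeration G l k s x \<longleftrightarrow>
     (\<forall>i\<le>k. bij_betw (x i) {0..s i} (layer G l (int i)))"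

definition layered_drawing ::
  "nat \<Rightarrow> (nat \<Rightarrow> nat) \<Rightarrow> (nat \<Rightarrow> nat \<Rightarrow> 'a) \<Rightarrow> ('a \<Rightarrow> real \<times> real) \<Rightarrow> bool" where
  "layered_drawing k s x pos \<longleftrightarrow>
     (\<forall>i\<le>k. \<forall>j\<le>s i. snd (pos (x i j)) = real i) \<and>
     (\<forall>i\<le>k. \<forall>j\<le>s i. \<forall>j'\<le>s i. j < j' \<longrightarrow> fst (pos (x i j)) < fst (pos (x i j')))"

text \<open>
  As the graphs are simple, a ribbon structure is given by \<open>nxt\<close>, where \<open>nxt x\<close> permutes
  the neighbours of \<open>x\<close> cyclically and \<open>xy\<^sup>+\<close> is the edge from \<open>x\<close> to \<open>nxt x y\<close>.
\<close>

definition plane_ribbon ::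
  "('a \<Rightarrow> int) \<Rightarrow> nat \<Rightarrow> (nat \<Rightarrow> nat) \<Rightarrow> (nat \<Rightarrow> nat \<Rightarrow> 'a) \<Rightarrow> 'a \<Rightarrow> 'a \<Rightarrow> 'a" where
  "plane_ribbon l k s x v =
     (let i = nat (l v);
          up = (if i < k then rev (map (x (i + 1)) [0..<s (i + 1) + 1]) else []);
          down = (if 0 < i then map (x (i - 1)) [0..<s (i - 1) + 1] else [])
      in cycle_of_list (up @ down))"

text \<open>The node-edge pair consisting of \<open>x\<close> and the edge \<open>xy\<close> is encoded as \<open>(x, y)\<close>.\<close>

definition tour_step ::
  "('a \<Rightarrow> 'a \<Rightarrow> 'a) \<Rightarrow> ('a \<times> 'a) set \<Rightarrow> 'a \<times> 'a \<Rightarrow> 'a \<times> 'a" where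
  "tour_step nxt T = (\<lambda>(x, y).
     if (x, y) \<in> T \<or> (y, x) \<in> T then (y, nxt y x) else (x, nxt x y))"

definition tour ::
  "('a \<Rightarrow> 'a \<Rightarrow> 'a) \<Rightarrow> 'a \<times> 'a \<Rightarrow> ('a \<times> 'a) set \<Rightarrow> ('a \<times> 'a) list" where
  "tour nxt b T =
     map (\<lambda>n. (tour_step nxt T ^^ n) b)
       [0..<(LEAST n. 0 < n \<and> (tour_step nxt T ^^ n) b = b)]"

definition precedes :: "'b list \<Rightarrow> 'b \<Rightarrow> 'b \<Rightarrow> bool" where
  "precedes xs a b \<longleftrightarrow> (\<exists>i j. i < j \<and> j < length xs \<and> xs ! i = a \<and> xs ! j = b)"

definition jaeger_tree ::
  "'a pair_pre_digraph \<Rightarrow> ('a \<Rightarrow> 'a \<Rightarrow> 'a) \<Rightarrow> 'a \<times> 'a \<Rightarrow> ('a \<times> 'a) set \<Rightarrow> bool" where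
  "jaeger_tree G nxt b T \<longleftrightarrow>
     is_spanning_tree G T \<and>
     (\<forall>(t, h) \<in> parcs G - T. precedes (tour nxt b T) (t, h) (h, t))"

definition complete_bipartite :: "'a set \<Rightarrow> 'a set \<Rightarrow> 'a pair_pre_digraph" where
  "complete_bipartite A B = \<lparr>pverts = A \<union> B, parcs = A \<times> B\<rparr>"

definition non_crossing :: "('a \<Rightarrow> real \<times> real) \<Rightarrow> ('a \<times> 'a) set \<Rightarrow> bool" where
  "non_crossing pos T \<longleftrightarrow>
     (\<forall>(a, b) \<in> T. \<forall>(c, d) \<in> T. (a, b) \<noteq> (c, d) \<longrightarrow>
        open_segment (pos a) (pos b) \<inter> open_segment (pos c) (pos d) = {})"

definition non_crossing_tree ::
  "('a \<Rightarrow> real \<times> real) \<Rightarrow> 'a set \<Rightarrow> 'a set \<Rightarrow> ('a \<times> 'a) set \<Rightarrow> bool" where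
  "non_crossing_tree pos A B T \<longleftrightarrow>
     is_spanning_tree (complete_bipartite A B) T \<and> non_crossing pos T"

definition non_crossing_comb_tree ::
  "'a pair_pre_digraph \<Rightarrow> ('a \<Rightarrow> int) \<Rightarrow> nat \<Rightarrow> (nat \<Rightarrow> nat \<Rightarrow> 'a) \<Rightarrow> ('a \<Rightarrow> real \<times> real) \<Rightarrow>
   ('a \<times> 'a) set \<Rightarrow> bool" where
  "non_crossing_comb_tree G l k x pos T \<longleftrightarrow>
     is_spanning_tree G T \<and>
     (\<exists>D U :: nat \<Rightarrow> 'a set. \<exists>S :: nat \<Rightarrow> ('a \<times> 'a) set.
        (\<forall>i\<le>k. D i \<union> U i = layer G l (int i) - {x i 0} \<and> D i \<inter> U i = {}) \<and>
        D 0 = {} \<and> U k = {} \<and>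
        T = (\<Union>i\<in>{1..k}. S i) \<and>
        (\<forall>i\<in>{1..k}.
           non_crossing_tree pos ({x (i - 1) 0} \<union> U (i - 1)) ({x i 0} \<union> D i) (S i)))"

end

theory Submission
  imports Defs "HOL-Library.List_Lexorder"
begin

text \<open>
  Call the vertices \<open>x i 0\<close> the spine. Both classes of trees turn out to be the spanning trees with
  three properties, collected in the locale \<open>comb_layered_tree\<close>: all edges between consecutive
  spine vertices belong to the tree, a vertex off the spine has tree edges only upwards or only
  downwards, and two tree edges between the same layers do not cross. For comb-trees this is mostly a
  reformulation: \<open>U i\<close> and \<open>D i\<close> consist of the vertices off the spine with edges upwards and downwards, and
  the part of the tree between two layers is connected because a path towards the spine cannot
  leave this part before it reaches the spine.

  The link to Jaeger trees is the following property of tours. Removing a tree edge \<open>uv\<close> splits the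
  tree into two sides, and the tour enters the side of \<open>v\<close> only with \<open>(u, v)\<close> and leaves it only with
  \<open>(v, u)\<close>. So the tour passes every node-edge pair, the pairs on the side of a tree edge away
  from the start form an interval (\<open>side_times\<close>), the pairs at a vertex appear in ribbon order starting after the
  edge to its parent (\<open>time_nxt\<close>), and the tour cannot alternate between two disjoint vertices or
  edges of the tree (\<open>no_alternation\<close>).

  Let \<open>T\<close> be a Jaeger tree. Read backwards, the tour starts with the spine edges one after the
  other: an edge between spine vertices outside \<open>T\<close> would have to be seen from its
  head even later, where no room is left (\<open>spine\<close>). Let \<open>\<tau> i\<close> be the time at which the tour turns
  upwards at \<open>x i 0\<close>. The Jaeger condition for the edges at \<open>x (i + 1) 0\<close> shows that each vertex
  of layer \<open>i\<close> is reached before \<open>\<tau> (i + 1)\<close>, and that no vertex of layer \<open>i + 2\<close> is. As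
  the tour returns to \<open>x (i + 1) 0\<close> at its end, a vertex off the spine cannot be met on both sides of \<open>\<tau> (i + 1)\<close>, so a vertex with
  tree edges in both directions lies on the spine (\<open>one_sided\<close>). Between two layers, the lower vertices
  are entered from left to right (\<open>first_time_increasing\<close>), and the upper vertices are left for the
  last time from right to left (\<open>last_time_decreasing\<close>). Crossing tree edges would then force an
  alternation (\<open>no_crossing\<close>).

  Conversely, if \<open>T\<close> has the three properties, each node-edge pair gets an explicit list of
  integers as its key, and each step of the tour, except the last one, increases the key
  lexicographically (\<open>key_step_up\<close>, \<open>key_step_down\<close>). So the keys determine the order of the tour, and
  for an edge outside \<open>T\<close> the key at the tail is the smaller one (\<open>up_key_less_down_key\<close>).
\<close>

section \<open>Trees as symmetric relations\<close>

lemma arcs_ends_with_proj_mk_symmetric: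
  "arcs_ends (with_proj (mk_symmetric (with_proj \<lparr>pverts = V, parcs = T\<rparr>))) = T \<union> T\<inverse>"
  by (auto simp: mk_symmetric_def arcs_ends_def arc_to_ends_def)

lemma connected_iff_rtrancl:
  assumes "T \<subseteq> V \<times> V"
  shows "Digraph_Component.connected (with_proj \<lparr>pverts = V, parcs = T\<rparr>) \<longleftrightarrow>
    V \<noteq> {} \<and> (\<forall>u\<in>V. \<forall>v\<in>V. (u, v) \<in> (T \<union> T\<inverse>)\<^sup>*)"
proof -
  let ?M = "with_proj (mk_symmetric (with_proj \<lparr>pverts = V, parcs = T\<rparr>))"
  have verts: "verts ?M = V"
    by (simp add: mk_symmetric_def)
  have "wf_digraph ?M"
    using assms by unfold_locales (auto simp: mk_symmetric_def)
  have "u \<rightarrow>\<^sup>*\<^bsub>?M\<^esub> v \<longleftrightarrow> (u, v) \<in> (T \<union> T\<inverse>)\<^sup>*" if "u \<in> V" "v \<in> V" for u v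
  proof
    assume "u \<rightarrow>\<^sup>*\<^bsub>?M\<^esub> v"
    then show "(u, v) \<in> (T \<union> T\<inverse>)\<^sup>*"
      unfolding reachable_def arcs_ends_with_proj_mk_symmetric by (rule rtrancl_on_rtranclI)
  next
    assume "(u, v) \<in> (T \<union> T\<inverse>)\<^sup>*"
    then show "u \<rightarrow>\<^sup>*\<^bsub>?M\<^esub> v"
    proof (induction rule: rtrancl_induct)
      case base
      then show ?case
        using that verts by (simp add: reachable_def)
    next
      case (step y z)
      then show ?case
        using \<open>wf_digraph ?M\<close> wf_digraph.reachable_adj_trans
        by (metis arcs_ends_with_proj_mk_symmetric)
    qed
  qed
  then show ?thesis
    unfolding Digraph_Component.connected_def strongly_connected_def verts by blast
qed

text \<open>
  A path from \<open>v\<close> back to \<open>u\<close> that avoids the edge \<open>uv\<close> would close up with it to a cycle. The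
  length of this cycle is at least 3, as the path cannot consist of the reversed arc alone.
\<close>

lemma und_tree_bridge:
  assumes tree: "und_tree \<lparr>pverts = V, parcs = T\<rparr>" and TV: "T \<subseteq> V \<times> V"
    and edge: "(u, v) \<in> T \<union> T\<inverse>" and "u \<noteq> v"
  shows "(v, u) \<notin> (T \<union> T\<inverse> - {(u, v), (v, u)})\<^sup>*"
proof
  let ?M = "with_proj (mk_symmetric (with_proj \<lparr>pverts = V, parcs = T\<rparr>))"
  let ?R = "T \<union> T\<inverse> - {(u, v), (v, u)}"
  let ?K = "with_proj \<lparr>pverts = V, parcs = ?R\<rparr>"
  assume "(v, u) \<in> ?R\<^sup>*"
  interpret K: wf_digraph ?K
    using TV by unfold_locales auto
  have "arcs_ends ?K = ?R"
    by (auto simp: arcs_ends_def arc_to_ends_def)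
  have "v \<in> V"
    using TV edge by auto
  have "v \<rightarrow>\<^sup>*\<^bsub>?K\<^esub> w" if "(v, w) \<in> ?R\<^sup>*" for w
    using that
  proof (induction rule: rtrancl_induct)
    case base
    then show ?case
      using \<open>v \<in> V\<close> by (simp add: reachable_def)
  next
    case (step y z)
    then show ?case
      using K.reachable_adj_trans \<open>arcs_ends ?K = ?R\<close> by metis
  qed
  then have "v \<rightarrow>\<^sup>*\<^bsub>?K\<^esub> u"
    using \<open>(v, u) \<in> ?R\<^sup>*\<close> .
  then obtain p where p: "K.apath v p u"
    using K.reachable_apath by blast
  then have p_walk: "K.awalk v p u" and p_distinct: "distinct (K.awalk_verts v p)"
    by (auto simp: K.apath_def)
  have p_len: "2 \<le> length p"
  proof (rule ccontr)
    assume "\<not> 2 \<le> length p"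
    then consider "p = []" | e where "p = [e]"
      by (cases p; cases "tl p") auto
    then show False
      using p_walk \<open>u \<noteq> v\<close> by cases (auto simp: K.awalk_def)
  qed
  have comp: "compatible ?K ?M"
    by auto
  have p_arcs: "set p \<subseteq> ?R"
    using p_walk by (simp add: K.awalk_def)
  have "verts ?M = V" "arcs ?M = T \<union> T\<inverse>"
    by (force simp: mk_symmetric_def)+
  then have "pre_digraph.awalk ?M u ((u, v) # p) u"
    using p_walk p_arcs edge TV unfolding pre_digraph.awalk_def pre_digraph.cas.simps
    by (auto simp: compatible_cas[OF comp] simp del: with_proj_simps(2))
  moreover have "distinct (tl (pre_digraph.awalk_verts ?M u ((u, v) # p)))"
    using p_distinct by (simp add: pre_digraph.awalk_verts.simps compatible_awalk_verts[OF comp])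
  ultimately have "und_cycle \<lparr>pverts = V, parcs = T\<rparr> ((u, v) # p)"
    using p_len unfolding und_cycle_def pre_digraph.cycle_def by auto
  then show False
    using tree by (auto simp: und_tree_def)
qed

lemma und_cycle_mono:
  assumes "und_cycle \<lparr>pverts = V, parcs = T\<rparr> p" "V \<subseteq> V'" "T \<subseteq> T'"
  shows "und_cycle \<lparr>pverts = V', parcs = T'\<rparr> p"
proof -
  let ?M = "\<lambda>V T. with_proj (mk_symmetric (with_proj \<lparr>pverts = V, parcs = T\<rparr>))"
  have comp: "compatible (?M V T) (?M V' T')"
    by auto
  show ?thesis
    using assms unfolding und_cycle_def pre_digraph.cycle_def pre_digraph.awalk_def
      compatible_cas[OF comp] compatible_awalk_verts[OF comp]
    by (fastforce simp: mk_symmetric_def)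
qed

section \<open>The tour of a tree in a ribbon graph\<close>

text \<open>
  A ribbon graph with a spanning tree \<open>T\<close> and the basis \<open>(r, b)\<close>. The map \<open>nxt v\<close> permutes the
  neighbours of \<open>v\<close> in a single cycle. Acyclicity of \<open>T\<close> appears as the statement that every tree
  edge is a bridge, which is the form in which the tour uses it.
\<close>

locale ribbon_tree =
  fixes V :: "'a set" and N :: "'a \<Rightarrow> 'a set" and nxt :: "'a \<Rightarrow> 'a \<Rightarrow> 'a"
    and T :: "('a \<times> 'a) set" and r b :: 'a
  assumes finite_V: "finite V"
    and N_subset: "v \<in> V \<Longrightarrow> N v \<subseteq> V"
    and N_sym: "v \<in> V \<Longrightarrow> w \<in> N v \<Longrightarrow> v \<in> N w"
    and N_irrefl: "v \<notin> N v"
    and nxt_bij: "v \<in> V \<Longrightarrow> bij_betw (nxt v) (N v) (N v)"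
    and nxt_transitive: "v \<in> V \<Longrightarrow> y \<in> N v \<Longrightarrow> z \<in> N v \<Longrightarrow> \<exists>n. (nxt v ^^ n) y = z"
    and T_adj: "(u, v) \<in> T \<Longrightarrow> u \<in> V \<and> v \<in> N u"
    and T_connected: "u \<in> V \<Longrightarrow> v \<in> V \<Longrightarrow> (u, v) \<in> (T \<union> T\<inverse>)\<^sup>*"
    and T_bridge: "(u, v) \<in> T \<union> T\<inverse> \<Longrightarrow> (v, u) \<notin> (T \<union> T\<inverse> - {(u, v), (v, u)})\<^sup>*"
    and r_in: "r \<in> V" and b_in: "b \<in> N r"
begin

abbreviation R :: "('a \<times> 'a) set" where "R \<equiv> T \<union> T\<inverse>"

abbreviation H :: "('a \<times> 'a) set" where "H \<equiv> Sigma V N"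

abbreviation step :: "'a \<times> 'a \<Rightarrow> 'a \<times> 'a" where "step \<equiv> tour_step nxt T"

lemma R_sym: "(u, v) \<in> R \<Longrightarrow> (v, u) \<in> R"
  by auto

lemma R_in_H: "(u, v) \<in> R \<Longrightarrow> (u, v) \<in> H"
  using T_adj N_sym N_subset by blast

lemma R_irrefl: "(u, v) \<in> R \<Longrightarrow> u \<noteq> v"
  using R_in_H N_irrefl by blast

lemma H_sym: "(u, v) \<in> H \<Longrightarrow> (v, u) \<in> H"
  using N_sym N_subset by blast

lemma nxt_in: "v \<in> V \<Longrightarrow> y \<in> N v \<Longrightarrow> nxt v y \<in> N v"
  using nxt_bij bij_betw_apply by metis

lemma step_tree: "(u, v) \<in> R \<Longrightarrow> step (u, v) = (v, nxt v u)"
  by (auto simp: tour_step_def)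

lemma step_nontree: "(u, v) \<notin> R \<Longrightarrow> step (u, v) = (u, nxt u v)"
  by (auto simp: tour_step_def)

lemma step_in_H:
  assumes "h \<in> H"
  shows "step h \<in> H"
proof (cases h)
  case (Pair x y)
  then have "x \<in> V" "y \<in> N x" "y \<in> V" "x \<in> N y"
    using assms H_sym[of x y] by auto
  then show ?thesis
    using nxt_in Pair by (cases "(x, y) \<in> R") (simp_all only: step_tree step_nontree mem_Sigma_iff not_False_eq_True)
qed

lemma funpow_step_in_H: "h \<in> H \<Longrightarrow> (step ^^ n) h \<in> H"
  by (induction n) (simp_all add: step_in_H del: mem_Sigma_iff)

lemma inj_on_step: "inj_on step H"
proof (rule inj_onI)
  fix g h assume "g \<in> H" "h \<in> H" "step g = step h"
  moreover obtain x y x' y' where gh: "g = (x, y)" "h = (x', y')"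
    by fastforce
  ultimately have V: "x \<in> V" "y \<in> N x" "x' \<in> V" "y' \<in> N x'" "y \<in> V" "x \<in> N y" "y' \<in> V" "x' \<in> N y'"
    using H_sym[of x y] H_sym[of x' y'] by auto
  have inj: "a = c" if "w \<in> V" "a \<in> N w" "c \<in> N w" "nxt w a = nxt w c" for w a c
    using nxt_bij[of w] that by (meson bij_betw_def inj_onD)
  have eq: "step (x, y) = step (x', y')"
    using \<open>step g = step h\<close> gh by simp
  show "g = h"
  proof (cases "(x, y) \<in> R"; cases "(x', y') \<in> R")
    assume "(x, y) \<in> R" "(x', y') \<in> R"
    then have "y = y'" "nxt y x = nxt y x'"
      using eq by (simp_all only: step_tree prod.inject) metis
    then show ?thesis
      using inj[of y x x'] V gh by simp
  next
    assume "(x, y) \<notin> R" "(x', y') \<notin> R"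
    then have "x = x'" "nxt x y = nxt x y'"
      using eq by (simp_all only: step_nontree prod.inject not_False_eq_True) metis
    then show ?thesis
      using inj[of x y y'] V gh by simp
  next
    assume R: "(x, y) \<in> R" "(x', y') \<notin> R"
    then have "y = x'" "nxt y x = nxt y y'"
      using eq by (simp_all only: step_tree step_nontree prod.inject not_False_eq_True) metis
    then have "x = y'"
      using inj[of y x y'] V by simp
    then show ?thesis
      using R \<open>y = x'\<close> R_sym by blast
  next
    assume R: "(x, y) \<notin> R" "(x', y') \<in> R"
    then have "x = y'" "nxt x y = nxt x x'"
      using eq by (simp_all only: step_tree step_nontree prod.inject not_False_eq_True) metis
    then have "y = x'"
      using inj[of x y x'] V by simp
    then show ?thesis
      using R \<open>x = y'\<close> R_sym by blast
  qed
qed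

lemma finite_H: "finite H"
  using finite_V N_subset by (meson finite_SigmaI finite_subset)

lemma step_recurrent:
  assumes "h \<in> H"
  shows "\<exists>n>0. (step ^^ n) h = h"
proof -
  have inj: "inj_on (step ^^ n) H" for n
  proof (induction n)
    case (Suc n)
    have "inj_on step ((step ^^ n) ` H)"
      using inj_on_subset[OF inj_on_step] funpow_step_in_H by blast
    then show ?case
      using comp_inj_on[OF Suc.IH] unfolding funpow.simps by blast
  qed simp
  have "finite (range (\<lambda>n. (step ^^ n) h))"
    by (rule finite_subset[OF _ finite_H]) (use funpow_step_in_H[OF assms] in blast)
  then have "\<not> inj (\<lambda>n. (step ^^ n) h)"
    using finite_imageD infinite_UNIV_nat by blast
  then obtain i j where ij: "i < j" "(step ^^ i) h = (step ^^ j) h"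
    unfolding inj_def by (metis nat_neq_iff)
  then have "(step ^^ i) ((step ^^ (j - i)) h) = (step ^^ i) h"
    using funpow_add[of i "j - i" step] by simp
  then have "(step ^^ (j - i)) h = h"
    using inj_onD[OF inj[of i]] assms funpow_step_in_H[OF assms] by blast
  then show ?thesis
    using \<open>i < j\<close> by (intro exI[of _ "j - i"]) simp
qed

text \<open>
  One of the two components that are left when the tree edge \<open>uv\<close> is removed, described by its
  only exit. In this form the complement of a side is a side again.
\<close>

definition side :: "'a \<Rightarrow> 'a \<Rightarrow> 'a set \<Rightarrow> bool" where
  "side u v A \<longleftrightarrow> v \<in> A \<and> u \<notin> A \<and> (\<forall>p q. (p, q) \<in> R \<longrightarrow> p \<in> A \<longrightarrow> q \<notin> A \<longrightarrow> p = v \<and> q = u)"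

lemma side_reachable:
  assumes "(u, v) \<in> R"
  shows "side u v {w. (v, w) \<in> (R - {(u, v), (v, u)})\<^sup>*}"
proof -
  let ?R = "R - {(u, v), (v, u)}"
  have "p = v \<and> q = u" if "(p, q) \<in> R" "(v, p) \<in> ?R\<^sup>*" "(v, q) \<notin> ?R\<^sup>*" for p q
  proof -
    have "(p, q) \<notin> ?R"
      using that(2,3) rtrancl_into_rtrancl by metis
    moreover have "p \<noteq> u"
      using T_bridge[OF assms] that(2) by blast
    ultimately show ?thesis
      using that(1) by blast
  qed
  then show ?thesis
    using T_bridge[OF assms] unfolding side_def by blast
qed

lemma side_swap:
  assumes "side u v A"
  shows "side v u (- A)"
proof -
  have "p = u \<and> q = v" if "(p, q) \<in> R" "p \<notin> A" "q \<in> A" for p q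
    using assms R_sym[OF that(1)] that(2,3) unfolding side_def by metis
  then show ?thesis
    using assms unfolding side_def by simp
qed

lemma side_step_in:
  "side u v A \<Longrightarrow> fst h \<in> A \<Longrightarrow> h \<noteq> (v, u) \<Longrightarrow> fst (step h) \<in> A"
proof (cases h)
  case (Pair p q)
  assume "side u v A" "fst h \<in> A" "h \<noteq> (v, u)"
  then show ?thesis
    using Pair step_tree[of p q] step_nontree[of p q] unfolding side_def
    by (metis fst_conv)
qed

lemma side_step_out:
  "side u v A \<Longrightarrow> fst h \<notin> A \<Longrightarrow> h \<noteq> (u, v) \<Longrightarrow> fst (step h) \<notin> A"
  using side_step_in[OF side_swap, of u v A h] by simp

abbreviation seq :: "nat \<Rightarrow> 'a \<times> 'a" where "seq n \<equiv> (step ^^ n) (r, b)"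

lemma basis_in_H: "(r, b) \<in> H"
  using r_in b_in by simp

lemma seq_in_H: "seq n \<in> H"
  using funpow_step_in_H basis_in_H by blast

text \<open>
  After \<open>(u, v)\<close> the orbit is on the side of \<open>v\<close>. Being periodic, it has to return to \<open>u\<close>, and
  \<open>(v, u)\<close> is the only way out.
\<close>

lemma orbit_swap:
  assumes "(u, v) \<in> R" "(u, v) \<in> range seq"
  shows "(v, u) \<in> range seq"
proof (rule ccontr)
  assume notin: "(v, u) \<notin> range seq"
  obtain A where A: "side u v A"
    using side_reachable assms by blast
  obtain m where m: "(u, v) = seq m"
    using assms by blast
  have avoid: "(step ^^ n) (u, v) \<noteq> (v, u)" for n
  proof -
    have "(step ^^ n) (u, v) = seq (n + m)"
      unfolding m funpow_add comp_apply ..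
    then show ?thesis
      using notin by (metis rangeI)
  qed
  have "fst ((step ^^ Suc n) (u, v)) \<in> A" for n
  proof (induction n)
    case 0
    then show ?case
      using A step_tree[OF assms(1)] by (simp add: side_def)
  next
    case (Suc n)
    then show ?case
      using side_step_in[OF A _ avoid[of "Suc n"]] by simp
  qed
  moreover obtain n where "n > 0" "(step ^^ n) (u, v) = (u, v)"
    using step_recurrent R_in_H assms by blast
  ultimately have "u \<in> A"
    by (metis Suc_pred fst_conv)
  then show False
    using A by (simp add: side_def)
qed

text \<open>
  For a tree edge \<open>vw\<close>, the pair in question is the one that follows \<open>(w, v)\<close>.
\<close>

lemma orbit_nxt:
  assumes "(v, w) \<in> range seq"
  shows "(v, nxt v w) \<in> range seq"
proof -
  have closed: "step h \<in> range seq" if h: "h \<in> range seq" for h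
  proof -
    obtain n where "h = seq n"
      using h by blast
    then have "step h = seq (Suc n)"
      by simp
    then show ?thesis
      by blast
  qed
  show ?thesis
  proof (cases "(v, w) \<in> R")
    case True
    then show ?thesis
      using closed[OF orbit_swap[OF True assms]] step_tree[OF R_sym[OF True]] by metis
  next
    case False
    then show ?thesis
      using closed[OF assms] step_nontree[OF False] by metis
  qed
qed

lemma orbit_eq_H: "range seq = H"
proof
  show "range seq \<subseteq> H"
    using seq_in_H by blast
  have all_at: "(v, z) \<in> range seq" if "v \<in> V" "y \<in> N v" "z \<in> N v" "(v, y) \<in> range seq" for v y z
  proof -
    have "(v, (nxt v ^^ n) y) \<in> range seq" for n
      using that(4) by (induction n) (simp_all add: orbit_nxt)
    then show ?thesis
      using nxt_transitive that by metis
  qed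
  have "\<forall>w\<in>N v. (v, w) \<in> range seq" if "(r, v) \<in> R\<^sup>*" for v
    using that
  proof (induction rule: rtrancl_induct)
    case base
    have "(r, b) \<in> range seq"
      by (metis funpow_0 rangeI)
    then show ?case
      using all_at r_in b_in by blast
  next
    case (step y z)
    have "(y, z) \<in> H" "(z, y) \<in> H"
      using R_in_H R_sym step by blast+
    then have "(z, y) \<in> range seq"
      using step orbit_swap by blast
    then show ?case
      using all_at \<open>(z, y) \<in> H\<close> by blast
  qed
  then show "H \<subseteq> range seq"
    using T_connected[OF r_in] by blast
qed

definition period :: nat where
  "period = (LEAST n. 0 < n \<and> seq n = (r, b))"

lemma period_props: "0 < period" "seq period = (r, b)"
  using LeastI_ex[OF step_recurrent[OF basis_in_H]] unfolding period_def by auto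

lemma seq_neq_basis: "0 < n \<Longrightarrow> n < period \<Longrightarrow> seq n \<noteq> (r, b)"
  using not_less_Least unfolding period_def by blast

lemma bij_betw_seq: "bij_betw seq {..<period} H"
proof -
  have neq: "seq i \<noteq> seq j" if "i < j" "j < period" for i j
  proof
    assume eq: "seq i = seq j"
    have "seq (n + i) = seq (n + j)" for n
      using eq by (simp add: funpow_add)
    from this[of "period - j"] have "seq (period - j + i) = (r, b)"
      using that period_props by simp
    then show False
      using seq_neq_basis[of "period - j + i"] that by linarith
  qed
  have "inj_on seq {..<period}"
  proof (rule inj_onI)
    fix i j assume "i \<in> {..<period}" "j \<in> {..<period}" "seq i = seq j"
    then show "i = j"
      using neq[of i j] neq[of j i] by (cases i j rule: linorder_cases) simp_all
  qed
  moreover have "seq ` {..<period} = H"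
  proof -
    have "seq n \<in> seq ` {..<period}" for n
    proof (rule image_eqI)
      show "seq n = seq (n mod period)"
        using funpow_mod_eq[OF period_props(2), of n] by simp
    qed (use period_props in simp)
    then have "range seq = seq ` {..<period}"
      by blast
    then show ?thesis
      using orbit_eq_H by simp
  qed
  ultimately show ?thesis
    unfolding bij_betw_def ..
qed

definition time :: "'a \<times> 'a \<Rightarrow> nat" where
  "time = inv_into {..<period} seq"

lemma time_less: "h \<in> H \<Longrightarrow> time h < period"
  using bij_betw_seq inv_into_into[of h seq "{..<period}"]
  unfolding time_def bij_betw_def by auto

lemma seq_time: "h \<in> H \<Longrightarrow> seq (time h) = h"
  using bij_betw_seq f_inv_into_f[of h seq "{..<period}"]
  unfolding time_def bij_betw_def by auto

lemma time_seq: "n < period \<Longrightarrow> time (seq n) = n"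
  using bij_betw_seq inv_into_f_f[of seq "{..<period}" n]
  unfolding time_def bij_betw_def by blast

lemma time_inj: "g \<in> H \<Longrightarrow> h \<in> H \<Longrightarrow> time g = time h \<Longrightarrow> g = h"
  using seq_time by metis

lemma time_basis: "time (r, b) = 0"
  using time_seq[of 0] period_props by simp

lemma time_step:
  assumes "h \<in> H" "step h \<noteq> (r, b)"
  shows "time (step h) = Suc (time h)"
proof -
  have "seq (Suc (time h)) = step h"
    using seq_time assms(1) by simp
  moreover from this have "Suc (time h) < period"
    using time_less[OF assms(1)] assms(2) period_props by (metis Suc_lessI)
  ultimately show ?thesis
    using time_seq by metis
qed

lemma time_step_basis:
  assumes "h \<in> H" "step h = (r, b)"
  shows "Suc (time h) = period"
proof -
  have "seq (Suc (time h)) = (r, b)"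
    using seq_time assms by simp
  then show ?thesis
    using seq_neq_basis[of "Suc (time h)"] time_less[OF assms(1)] by linarith
qed

lemma precedes_tour_iff:
  assumes "g \<in> H" "h \<in> H"
  shows "precedes (tour nxt (r, b) T) g h \<longleftrightarrow> time g < time h"
proof -
  have "tour nxt (r, b) T = map seq [0..<period]"
    unfolding tour_def period_def ..
  then have "precedes (tour nxt (r, b) T) g h \<longleftrightarrow> (\<exists>i j. i < j \<and> j < period \<and> seq i = g \<and> seq j = h)"
    by (auto simp: precedes_def cong: conj_cong)
  also have "\<dots> \<longleftrightarrow> time g < time h"
  proof
    assume "\<exists>i j. i < j \<and> j < period \<and> seq i = g \<and> seq j = h"
    then obtain i j where "i < j" "j < period" "seq i = g" "seq j = h"
      by blast
    then show "time g < time h"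
      using time_seq[of i] time_seq[of j] by simp
  next
    assume "time g < time h"
    then show "\<exists>i j. i < j \<and> j < period \<and> seq i = g \<and> seq j = h"
      using seq_time assms time_less[OF assms(2)] by blast
  qed
  finally show ?thesis .
qed

text \<open>
  To determine the order of the tour it suffices to guess a function that increases in each step.
\<close>

lemma time_less_if_potential:
  fixes \<phi> :: "'a \<times> 'a \<Rightarrow> 'b::linorder"
  assumes incr: "\<And>h. h \<in> H \<Longrightarrow> step h \<noteq> (r, b) \<Longrightarrow> \<phi> h < \<phi> (step h)"
    and gh: "g \<in> H" "h \<in> H" "\<phi> g < \<phi> h"
  shows "time g < time h"
proof (rule ccontr)
  assume "\<not> time g < time h"
  moreover have "time g \<noteq> time h"
    using time_inj gh by blast
  ultimately have less: "time h < time g"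
    by simp
  have "\<phi> (seq i) < \<phi> (seq j)" if "i < j" "j < period" for i j
    using that
  proof (induction j)
    case (Suc j)
    have "\<phi> (seq j) < \<phi> (seq (Suc j))"
      using incr[OF seq_in_H[of j]] seq_neq_basis[of "Suc j"] Suc.prems by simp
    then show ?case
      using Suc by (cases "i = j") (auto intro: order.strict_trans)
  qed simp
  from this[OF less time_less] show False
    using gh seq_time by force
qed

text \<open>
  The tour starts at the root outside of \<open>A\<close>, enters \<open>A\<close> only with \<open>(u, v)\<close>, leaves it only with
  \<open>(v, u)\<close>, and passes each of these two pairs once.
\<close>

lemma side_times:
  assumes A: "side u v A" and "(u, v) \<in> R" "r \<notin> A" "h \<in> H"
  shows "fst h \<in> A \<longleftrightarrow> time (u, v) < time h \<and> time h \<le> time (v, u)"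
proof -
  have uv: "(u, v) \<in> H" "(v, u) \<in> H" and "v \<in> A" "u \<notin> A" "u \<noteq> v"
    using R_in_H R_sym R_irrefl assms unfolding side_def by blast+
  have "fst (seq n) \<in> A \<longleftrightarrow> time (u, v) < n \<and> n \<le> time (v, u)" if "n < period" for n
    using that
  proof (induction n rule: less_induct)
    case (less n)
    show ?case
    proof (cases n)
      case 0
      then show ?thesis
        using assms by simp
    next
      case (Suc m)
      then have IH: "fst (seq m) \<in> A \<longleftrightarrow> time (u, v) < m \<and> m \<le> time (v, u)" and m: "time (seq m) = m"
        using less time_seq by simp_all
      consider "seq m = (u, v)" | "seq m = (v, u)" | "seq m \<noteq> (u, v)" "seq m \<noteq> (v, u)"
        by blast
      then show ?thesis
      proof cases
        case 1
        then have "time (u, v) = m"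
          using m by simp
        have "\<not> time (v, u) < m"
        proof
          assume "time (v, u) < m"
          then show False
            using less.IH[of "time (v, u)"] seq_time[OF uv(2)] \<open>time (u, v) = m\<close> \<open>v \<in> A\<close> Suc less.prems by simp
        qed
        moreover have "time (v, u) \<noteq> m"
          using time_inj[OF uv] \<open>time (u, v) = m\<close> \<open>u \<noteq> v\<close> by auto
        ultimately show ?thesis
          using 1 Suc \<open>time (u, v) = m\<close> \<open>v \<in> A\<close> step_tree[OF assms(2)] by simp
      next
        case 2
        then have "time (v, u) = m"
          using m by simp
        then show ?thesis
          using 2 Suc \<open>u \<notin> A\<close> step_tree[OF R_sym[OF assms(2)]] by simp
      next
        case 3
        then have neq: "time (u, v) \<noteq> m" "time (v, u) \<noteq> m"
          using seq_time uv by auto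
        have "fst (seq n) \<in> A \<longleftrightarrow> fst (seq m) \<in> A"
          using side_step_in[OF A _ 3(2)] side_step_out[OF A _ 3(1)] Suc by auto
        then show ?thesis
          using IH neq Suc by auto
      qed
    qed
  qed
  then show ?thesis
    using seq_time[OF assms(4)] time_less[OF assms(4)] by metis
qed

text \<open>
  For the tree rooted at \<open>r\<close>, this says that \<open>u\<close> is the parent of \<open>v\<close>.
\<close>

definition par :: "'a \<Rightarrow> 'a \<Rightarrow> bool" where
  "par u v \<longleftrightarrow> (u, v) \<in> R \<and> time (u, v) < time (v, u)"

lemma par_or_par: "(u, v) \<in> R \<Longrightarrow> par u v \<or> par v u"
  using time_inj R_in_H R_sym R_irrefl unfolding par_def by (metis linorder_neqE_nat prod.inject)

lemma par_interval:
  assumes "par u v"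
  obtains A where "v \<in> A" "u \<notin> A"
    "\<And>h. h \<in> H \<Longrightarrow> fst h \<in> A \<longleftrightarrow> time (u, v) < time h \<and> time h \<le> time (v, u)"
proof -
  have uv: "(u, v) \<in> R" "time (u, v) < time (v, u)"
    using assms by (auto simp: par_def)
  obtain A where A: "side u v A"
    using side_reachable uv by blast
  have "r \<notin> A"
  proof
    assume "r \<in> A"
    then have "fst (u, v) \<in> - A \<longleftrightarrow> time (v, u) < time (u, v) \<and> time (u, v) \<le> time (u, v)"
      using side_times[OF side_swap[OF A] R_sym[OF uv(1)]] R_in_H[OF uv(1)] by blast
    then show False
      using A uv by (auto simp: side_def)
  qed
  then show ?thesis
    using that A side_times[OF A uv(1)] unfolding side_def by blast
qed

lemma par_child_times:
  assumes "par u v" "w \<in> N v"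
  shows "time (u, v) < time (v, w)" "time (v, w) \<le> time (v, u)"
proof -
  have "(v, w) \<in> H"
    using assms R_in_H R_sym unfolding par_def by blast
  with par_interval[OF assms(1)] show "time (u, v) < time (v, w)" "time (v, w) \<le> time (v, u)"
    by (metis fst_conv)+
qed

text \<open>
  The tour is on the side of \<open>v\<close>, and therefore not at \<open>u\<close>, between \<open>(u, v)\<close> and \<open>(v, u)\<close>.
\<close>

lemma par_parent_times:
  assumes "par u v" "w \<in> N u" "time (u, v) < time (u, w)"
  shows "time (v, u) < time (u, w)"
proof -
  have "(u, w) \<in> H"
    using assms R_in_H unfolding par_def by blast
  with par_interval[OF assms(1)] show ?thesis
    using assms(3) by (metis fst_conv not_le)
qed

lemma par_unique:
  assumes "par u v" "par w v"
  shows "u = w"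
proof -
  have H: "(v, u) \<in> H" "(v, w) \<in> H"
    using assms R_in_H R_sym unfolding par_def by blast+
  then have "time (v, u) = time (v, w)"
    using par_child_times assms by (simp add: dual_order.antisym)
  then show ?thesis
    using time_inj H by blast
qed

lemma not_par_root: "\<not> par u r"
  using par_child_times(1)[OF _ b_in] time_basis by fastforce

lemma par_nxt:
  assumes "par u v"
  shows "time (v, nxt v u) = Suc (time (u, v))"
proof -
  have "v \<noteq> r"
    using assms not_par_root by blast
  then show ?thesis
    using assms time_step[of "(u, v)"] R_in_H[of u v] unfolding par_def by (simp add: step_tree)
qed

text \<open>
  The pair before the first visit of \<open>v\<close> is not at \<open>v\<close>, so it moves along a tree edge to \<open>v\<close>.
\<close>

lemma exists_par:
  assumes "v \<in> V" "v \<noteq> r"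
  obtains u where "par u v"
proof -
  from T_connected[OF assms(1) r_in] assms(2) obtain w where "(v, w) \<in> R"
    by (meson converse_rtranclE)
  then have "\<exists>n. \<exists>w\<in>N v. time (v, w) = n"
    using R_in_H by blast
  define m where "m = (LEAST n. \<exists>w\<in>N v. time (v, w) = n)"
  obtain w where w: "w \<in> N v" "time (v, w) = m"
    using LeastI_ex[OF \<open>\<exists>n. \<exists>w\<in>N v. time (v, w) = n\<close>] unfolding m_def by blast
  have min: "m \<le> time (v, w')" if "w' \<in> N v" for w'
    using that Least_le[of "\<lambda>n. \<exists>w\<in>N v. time (v, w) = n"] unfolding m_def by blast
  have "(v, w) \<in> H"
    using w assms by blast
  then have "m \<noteq> 0"
    using seq_time[OF \<open>(v, w) \<in> H\<close>] w assms(2) by (metis funpow_0 prod.inject)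
  then obtain n where n: "m = Suc n"
    using not0_implies_Suc by blast
  obtain x y where xy: "seq n = (x, y)"
    by fastforce
  have step: "step (x, y) = (v, w)"
    using seq_time[OF \<open>(v, w) \<in> H\<close>] w n xy by simp
  have "time (x, y) = n"
    using time_seq[of n] time_less[OF \<open>(v, w) \<in> H\<close>] w n xy by simp
  have xyH: "(x, y) \<in> H"
    using seq_in_H[of n] unfolding xy .
  then have "x \<noteq> v"
    using min[of y] n \<open>time (x, y) = n\<close> by auto
  then have R: "(x, y) \<in> R" "y = v"
    using step by (cases "(x, y) \<in> R"; simp add: step_tree step_nontree)+
  then have "par x v"
    using min[of x] n \<open>time (x, y) = n\<close> H_sym[OF xyH] unfolding par_def by auto
  then show thesis
    using that by blast
qed

text \<open>
  The pairs at a vertex are passed in ribbon order, with a jump back in time only at the edge to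
  the parent and, at the root, at the basis.
\<close>

lemma time_nxt:
  assumes "v \<in> V" "y \<in> N v" "\<not> par y v" "(v, nxt v y) \<noteq> (r, b)"
  shows "time (v, y) < time (v, nxt v y)"
proof (cases "(v, y) \<in> R")
  case True
  then have "par v y"
    using assms par_or_par by blast
  moreover have "time (v, nxt v y) = Suc (time (y, v))"
    using True time_step[of "(y, v)"] R_in_H R_sym assms(4) by (metis step_tree)
  ultimately show ?thesis
    unfolding par_def by simp
next
  case False
  then show ?thesis
    using time_step[of "(v, y)"] assms by (simp add: step_nontree)
qed

definition first_time :: "'a \<Rightarrow> nat" where
  "first_time v = Min ((\<lambda>w. time (v, w)) ` N v)"

definition last_time :: "'a \<Rightarrow> nat" where
  "last_time v = Max ((\<lambda>w. time (v, w)) ` N v)"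

lemma finite_times: "v \<in> V \<Longrightarrow> finite ((\<lambda>w. time (v, w)) ` N v)"
  using finite_V N_subset by (meson finite_imageI finite_subset)

lemma first_time_le: "(v, w) \<in> H \<Longrightarrow> first_time v \<le> time (v, w)"
  unfolding first_time_def using finite_times by (intro Min_le) auto

lemma le_last_time: "(v, w) \<in> H \<Longrightarrow> time (v, w) \<le> last_time v"
  unfolding last_time_def using finite_times by (intro Max_ge) auto

lemma first_time_attained:
  assumes "(v, w) \<in> H"
  obtains y where "(v, y) \<in> H" "time (v, y) = first_time v"
proof -
  have "first_time v \<in> (\<lambda>w. time (v, w)) ` N v"
    unfolding first_time_def using assms finite_times by (intro Min_in) auto
  then show thesis
    using that assms by auto
qed

lemma last_time_attained:
  assumes "(v, w) \<in> H"
  obtains y where "(v, y) \<in> H" "time (v, y) = last_time v"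
proof -
  have "last_time v \<in> (\<lambda>w. time (v, w)) ` N v"
    unfolding last_time_def using assms finite_times by (intro Max_in) auto
  then show thesis
    using that assms by auto
qed

lemma par_in_H:
  assumes "par u v"
  shows "(u, v) \<in> H" "(v, u) \<in> H" "(v, nxt v u) \<in> H"
proof -
  show "(u, v) \<in> H" "(v, u) \<in> H"
    using assms R_in_H R_sym unfolding par_def by blast+
  then show "(v, nxt v u) \<in> H"
    using nxt_in by blast
qed

lemma first_time_par:
  assumes "par u v"
  shows "first_time v = Suc (time (u, v))"
proof (rule antisym)
  show "first_time v \<le> Suc (time (u, v))"
    using first_time_le[OF par_in_H(3)[OF assms]] par_nxt[OF assms] by simp
  obtain y where "(v, y) \<in> H" "time (v, y) = first_time v"
    using first_time_attained[OF par_in_H(2)[OF assms]] .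
  then show "Suc (time (u, v)) \<le> first_time v"
    using par_child_times(1)[OF assms, of y] by simp
qed

lemma last_time_par:
  assumes "par u v"
  shows "last_time v = time (v, u)"
proof (rule antisym)
  show "time (v, u) \<le> last_time v"
    using le_last_time[OF par_in_H(2)[OF assms]] .
  obtain y where "(v, y) \<in> H" "time (v, y) = last_time v"
    using last_time_attained[OF par_in_H(2)[OF assms]] .
  then show "last_time v \<le> time (v, u)"
    using par_child_times(2)[OF assms, of y] by simp
qed

lemma time_across:
  assumes "(u, v) \<in> R" "(v, nxt v u) \<noteq> (r, b)"
  shows "time (v, nxt v u) = Suc (time (u, v))"
  using time_step[OF R_in_H[OF assms(1)]] step_tree[OF assms(1)] assms(2) by simp

text \<open>
  Some tree edge separates the connected sets \<open>{p1, p2}\<close> and \<open>{q1, q2}\<close>. The pairs on one of its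
  sides form an interval of the tour, so the tour cannot change sides three times.
\<close>

lemma no_alternation:
  assumes p: "(p1, p2) \<in> R \<or> p1 = p2" and q: "(q1, q2) \<in> R \<or> q1 = q2"
    and disj: "{p1, p2} \<inter> {q1, q2} = {}"
    and H: "(p1, a1) \<in> H" "(q1, c1) \<in> H" "(p2, a2) \<in> H" "(q2, c2) \<in> H"
    and times: "time (p1, a1) < time (q1, c1)" "time (q1, c1) < time (p2, a2)"
      "time (p2, a2) < time (q2, c2)"
  shows False
proof -
  \<comment> \<open>The edge \<open>vu\<close> on which a path from \<open>q1\<close> first meets \<open>{p1, p2}\<close> separates the two sets.\<close>
  have "\<exists>v u. (q1, v) \<in> (R \<inter> (- {p1, p2}) \<times> (- {p1, p2}))\<^sup>* \<and> (v, u) \<in> R \<and> v \<notin> {p1, p2} \<and> u \<in> {p1, p2}"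
  proof -
    have "z \<in> {p1, p2} \<Longrightarrow> ?thesis" if "(q1, z) \<in> R\<^sup>*" for z
    proof -
      have "(q1, z) \<in> (R \<inter> (- {p1, p2}) \<times> (- {p1, p2}))\<^sup>* \<and> z \<notin> {p1, p2} \<or> ?thesis"
        using that
      proof (induction rule: rtrancl_induct)
        case base
        then show ?case
          using disj by auto
      next
        case (step y z)
        then show ?case
          by (cases "z \<in> {p1, p2}") (blast intro: rtrancl_into_rtrancl)+
      qed
      then show "z \<in> {p1, p2} \<Longrightarrow> ?thesis"
        by blast
    qed
    then show ?thesis
      using T_connected[of q1 p1] H by blast
  qed
  then obtain u v where walk: "(q1, v) \<in> (R \<inter> (- {p1, p2}) \<times> (- {p1, p2}))\<^sup>*"
    and vu: "(v, u) \<in> R" "v \<notin> {p1, p2}" "u \<in> {p1, p2}"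
    by blast
  let ?R = "R - {(u, v), (v, u)}"
  define A where "A = {w. (v, w) \<in> ?R\<^sup>*}"
  have A: "side u v A"
    using side_reachable[OF R_sym[OF vu(1)]] unfolding A_def .
  have sym: "sym ?R"
    by (auto simp: sym_def)
  have "(q1, v) \<in> ?R\<^sup>*"
    by (rule subsetD[OF rtrancl_mono walk]) (use vu in auto)
  then have "q1 \<in> A"
    using symD[OF sym_rtrancl[OF sym]] unfolding A_def by blast
  moreover have "q2 \<in> A"
    using \<open>q1 \<in> A\<close> q disj vu(3) rtrancl_into_rtrancl[of v q1 ?R q2] unfolding A_def by auto
  moreover have closed: "p1 \<in> A \<longleftrightarrow> p2 \<in> A"
    using p vu(2,3) rtrancl_into_rtrancl[of v p1 ?R p2] rtrancl_into_rtrancl[of v p2 ?R p1]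
    unfolding A_def by auto
  moreover have "u \<notin> A"
    using A by (simp add: side_def)
  ultimately have mem: "p1 \<notin> A" "p2 \<notin> A" "q1 \<in> A" "q2 \<in> A"
    using vu(3) by auto
  show False
  proof (cases "r \<in> A")
    case True
    then have "fst h \<notin> A \<longleftrightarrow> time (v, u) < time h \<and> time h \<le> time (u, v)" if "h \<in> H" for h
      using side_times[OF side_swap[OF A] R_sym[OF R_sym[OF vu(1)]] _ that] by simp
    from this[OF H(1)] this[OF H(2)] this[OF H(3)] show False
      using mem times by simp
  next
    case False
    note st = side_times[OF A R_sym[OF vu(1)] False]
    from st[OF H(2)] st[OF H(3)] st[OF H(4)] show False
      using mem times by simp
  qed
qed

end

section \<open>Layer-complete graphs and their ribbon structure\<close>

lemma cycle_of_list_nth: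
  assumes "distinct cs" "n < length cs"
  shows "cycle_of_list cs (cs ! n) = cs ! (Suc n mod length cs)"
proof -
  have "map (cycle_of_list cs) cs ! n = rotate 1 cs ! n"
    using cyclic_rotation[OF assms(1), of 1] by simp
  then show ?thesis
    using assms(2) by (simp add: nth_rotate del: rotate_Suc)
qed

lemma cycle_of_list_transitive:
  assumes "distinct cs" "y \<in> set cs" "z \<in> set cs"
  shows "\<exists>n. (cycle_of_list cs ^^ n) y = z"
proof -
  let ?L = "length cs"
  obtain i j where ij: "i < ?L" "y = cs ! i" "j < ?L" "z = cs ! j"
    using assms(2,3) by (metis in_set_conv_nth)
  have "map (cycle_of_list cs ^^ (?L - i + j)) cs ! i = rotate (?L - i + j) cs ! i"
    using cyclic_rotation[OF assms(1)] by simp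
  \<comment> \<open>Written as \<open>?L - i + j\<close>, the rotation from \<open>i\<close> to \<open>j\<close> is a natural number also for \<open>j < i\<close>.\<close>
  then have "(cycle_of_list cs ^^ (?L - i + j)) y = cs ! ((?L - i + j + i) mod ?L)"
    using ij by (simp add: nth_rotate)
  also have "\<dots> = z"
    using ij by (simp add: algebra_simps)
  finally show ?thesis
    by blast
qed

locale complete_layers =
  fixes G :: "'a pair_pre_digraph" and l :: "'a \<Rightarrow> int" and k :: nat and s :: "nat \<Rightarrow> nat"
    and x :: "nat \<Rightarrow> nat \<Rightarrow> 'a"
  assumes layer_complete_G: "layer_complete G l"
    and k_pos: "0 < k"
    and layers: "\<forall>i. layer G l i \<noteq> {} \<longleftrightarrow> 0 \<le> i \<and> i \<le> int k"
    and enumeration: "layer_enumeration G l k s x"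
begin

lemma layer_eq: "i \<le> k \<Longrightarrow> layer G l (int i) = x i ` {..s i}"
  using enumeration unfolding layer_enumeration_def bij_betw_def
  by (simp add: atLeast0AtMost)

lemma x_in:
  assumes "i \<le> k" "j \<le> s i"
  shows "x i j \<in> pverts G" "l (x i j) = int i"
  using layer_eq[OF assms(1)] assms(2) unfolding layer_def by blast+

lemma x_eq_iff:
  assumes "i \<le> k" "j \<le> s i" "i' \<le> k" "j' \<le> s i'"
  shows "x i j = x i' j' \<longleftrightarrow> i = i' \<and> j = j'"
proof
  assume eq: "x i j = x i' j'"
  then have "i = i'"
    using x_in(2) assms by (metis of_nat_eq_iff)
  moreover have "inj_on (x i) {0..s i}"
    using enumeration assms unfolding layer_enumeration_def bij_betw_def by blast
  ultimately show "i = i' \<and> j = j'"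
    using eq assms by (auto dest: inj_onD)
qed simp

lemma vertexE:
  assumes "v \<in> pverts G"
  obtains i j where "i \<le> k" "j \<le> s i" "v = x i j"
proof -
  have mem: "v \<in> layer G l (l v)"
    using assms by (simp add: layer_def)
  then obtain i where "l v = int i" "i \<le> k"
    using layers by (metis empty_iff nonneg_int_cases of_nat_le_iff)
  then show thesis
    using that mem layer_eq[of i] by auto
qed

lemma pair_digraph_G: "pair_digraph G"
  using layer_complete_G by (simp add: layer_complete_def oriented_graph_def)

lemma arc_iff:
  "(u, v) \<in> parcs G \<longleftrightarrow>
    (\<exists>i a b. i < k \<and> a \<le> s i \<and> b \<le> s (Suc i) \<and> u = x i a \<and> v = x (Suc i) b)"
proof
  assume arc: "(u, v) \<in> parcs G"
  interpret pair_digraph G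
    by (rule pair_digraph_G)
  have "u \<in> pverts G" "v \<in> pverts G"
    using arc arc_fst_in_verts arc_snd_in_verts by fastforce+
  then obtain i a i' b where ab: "i \<le> k" "a \<le> s i" "u = x i a" "i' \<le> k" "b \<le> s i'" "v = x i' b"
    using vertexE by metis
  moreover have "l v - l u = 1"
    using layer_complete_G arc by (auto simp: layer_complete_def layering_def)
  ultimately have "i' = Suc i"
    using x_in(2) by auto
  then show "\<exists>i a b. i < k \<and> a \<le> s i \<and> b \<le> s (Suc i) \<and> u = x i a \<and> v = x (Suc i) b"
    using ab by (metis Suc_le_eq)
next
  assume "\<exists>i a b. i < k \<and> a \<le> s i \<and> b \<le> s (Suc i) \<and> u = x i a \<and> v = x (Suc i) b"
  then obtain i a b where ab: "i < k" "a \<le> s i" "b \<le> s (Suc i)" "u = x i a" "v = x (Suc i) b"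
    by blast
  have "layer G l (int i) = x i ` {..s i}" "layer G l (int i + 1) = x (Suc i) ` {..s (Suc i)}"
    using layer_eq[of i] layer_eq[of "Suc i"] ab by (simp_all add: add.commute)
  then have "x i ` {..s i} \<times> x (Suc i) ` {..s (Suc i)} \<subseteq> parcs G"
    using layer_complete_G unfolding layer_complete_def by (metis atMost_iff empty_iff image_eqI le0)
  then show "(u, v) \<in> parcs G"
    using ab by blast
qed

lemma arc: "i < k \<Longrightarrow> a \<le> s i \<Longrightarrow> b \<le> s (Suc i) \<Longrightarrow> (x i a, x (Suc i) b) \<in> parcs G"
  unfolding arc_iff by blast

definition neighbours :: "'a \<Rightarrow> 'a set" where
  "neighbours v = {w. (v, w) \<in> parcs G \<or> (w, v) \<in> parcs G}"

abbreviation nxt :: "'a \<Rightarrow> 'a \<Rightarrow> 'a" where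
  "nxt \<equiv> plane_ribbon l k s x"

definition up_list :: "nat \<Rightarrow> 'a list" where
  "up_list i = (if i < k then rev (map (x (Suc i)) [0..<Suc (s (Suc i))]) else [])"

definition down_list :: "nat \<Rightarrow> 'a list" where
  "down_list i = (if 0 < i then map (x (i - 1)) [0..<Suc (s (i - 1))] else [])"

text \<open>
  The rules \<open>nxt_up\<close> and \<open>nxt_down\<close> give the successors within one of the two lists, and
  \<open>nxt_up_first\<close> and \<open>nxt_down_last\<close> those at their ends, where the other list may be empty.
\<close>

lemma nxt_eq: "i \<le> k \<Longrightarrow> j \<le> s i \<Longrightarrow> nxt (x i j) = cycle_of_list (up_list i @ down_list i)"
  by (simp add: plane_ribbon_def x_in up_list_def down_list_def)

lemma distinct_lists:
  assumes "i \<le> k"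
  shows "distinct (up_list i @ down_list i)"
proof -
  have inj: "inj_on (x i') {0..<Suc (s i')}" if "i' \<le> k" for i'
    using that by (auto intro!: inj_onI simp: x_eq_iff)
  have "distinct (up_list i)" "distinct (down_list i)"
    using assms inj[of "Suc i"] inj[of "i - 1"]
    by (auto simp: up_list_def down_list_def distinct_map simp del: upt_Suc)
  moreover have "set (up_list i) \<inter> set (down_list i) = {}"
    using assms by (auto simp: up_list_def down_list_def x_eq_iff simp del: upt_Suc)
  ultimately show ?thesis
    by simp
qed

lemma up_list_nth:
  "i < k \<Longrightarrow> m \<le> s (Suc i) \<Longrightarrow> up_list i ! (s (Suc i) - m) = x (Suc i) m"
  by (simp add: up_list_def rev_nth del: upt_Suc rev_map)

lemma down_list_nth: "m \<le> s i \<Longrightarrow> down_list (Suc i) ! m = x i m"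
  by (simp add: down_list_def del: upt_Suc)

lemma length_lists:
  "length (up_list i) = (if i < k then Suc (s (Suc i)) else 0)"
  "length (down_list i) = (if 0 < i then Suc (s (i - 1)) else 0)"
  by (simp_all add: up_list_def down_list_def)

lemma neighbours_eq:
  assumes "i \<le> k" "j \<le> s i"
  shows "neighbours (x i j) = set (up_list i @ down_list i)"
proof -
  have up: "set (up_list i) = (if i < k then x (Suc i) ` {..s (Suc i)} else {})"
    by (auto simp: up_list_def less_Suc_eq_le simp del: upt_Suc)
  have down: "set (down_list i) = (if 0 < i then x (i - 1) ` {..s (i - 1)} else {})"
    by (auto simp: down_list_def less_Suc_eq_le simp del: upt_Suc)
  have "(x i j, w) \<in> parcs G \<longleftrightarrow> w \<in> set (up_list i)" for w
  proof
    assume "(x i j, w) \<in> parcs G"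
    then obtain i' a b where "i' < k" "a \<le> s i'" "b \<le> s (Suc i')" "x i j = x i' a" "w = x (Suc i') b"
      unfolding arc_iff by blast
    then show "w \<in> set (up_list i)"
      using assms up x_eq_iff[of i j i' a] by auto
  qed (use assms arc in \<open>auto simp: up split: if_splits\<close>)
  moreover have "(w, x i j) \<in> parcs G \<longleftrightarrow> w \<in> set (down_list i)" for w
  proof
    assume "(w, x i j) \<in> parcs G"
    then obtain i' a b where "i' < k" "a \<le> s i'" "b \<le> s (Suc i')" "x i j = x (Suc i') b" "w = x i' a"
      unfolding arc_iff by blast
    then show "w \<in> set (down_list i)"
      using assms down x_eq_iff[of i j "Suc i'" b] by auto
  next
    assume "w \<in> set (down_list i)"
    then show "(w, x i j) \<in> parcs G"
      using assms arc[of "i - 1" _ j] by (auto simp: down split: if_splits)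
  qed
  ultimately show ?thesis
    by (auto simp: neighbours_def)
qed

lemma nxt_up:
  assumes "i < k" "j \<le> s i" "m < s (Suc i)"
  shows "nxt (x i j) (x (Suc i) (Suc m)) = x (Suc i) m"
proof -
  let ?L = "up_list i @ down_list i"
  have nth: "?L ! (s (Suc i) - m) = x (Suc i) m" if "m \<le> s (Suc i)" for m
    using that assms by (auto simp: nth_append length_lists up_list_nth)
  have "cycle_of_list ?L (?L ! (s (Suc i) - Suc m)) = ?L ! (Suc (s (Suc i) - Suc m) mod length ?L)"
    by (rule cycle_of_list_nth) (use assms distinct_lists in \<open>auto simp: length_lists\<close>)
  moreover have "Suc (s (Suc i) - Suc m) = s (Suc i) - m" "s (Suc i) - m < length ?L"
    using assms by (auto simp: length_lists)
  ultimately show ?thesis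
    using nth[of m] nth[of "Suc m"] assms by (simp add: nxt_eq)
qed

lemma nxt_up_first:
  assumes "i < k" "j \<le> s i"
  shows "nxt (x i j) (x (Suc i) 0) = (if i = 0 then x (Suc 0) (s (Suc 0)) else x (i - 1) 0)"
proof -
  let ?L = "up_list i @ down_list i"
  have "cycle_of_list ?L (?L ! s (Suc i)) = ?L ! (Suc (s (Suc i)) mod length ?L)"
    by (rule cycle_of_list_nth) (use assms distinct_lists in \<open>auto simp: length_lists\<close>)
  moreover have "?L ! s (Suc i) = x (Suc i) 0"
    using up_list_nth[of i 0] assms by (simp add: nth_append length_lists)
  moreover have "?L ! (Suc (s (Suc i)) mod length ?L) = (if i = 0 then x (Suc 0) (s (Suc 0)) else x (i - 1) 0)"
  proof (cases i)
    case 0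
    then show ?thesis
      using up_list_nth[of i "s (Suc i)"] assms by (simp add: nth_append length_lists)
  next
    case (Suc i')
    then show ?thesis
      using down_list_nth[of 0 i'] assms by (simp add: nth_append length_lists)
  qed
  ultimately show ?thesis
    using assms by (simp add: nxt_eq)
qed

lemma nxt_down:
  assumes "i < k" "j \<le> s (Suc i)" "m < s i"
  shows "nxt (x (Suc i) j) (x i m) = x i (Suc m)"
proof -
  let ?U = "up_list (Suc i)" and ?D = "down_list (Suc i)"
  let ?L = "?U @ ?D"
  have nth: "?L ! (length ?U + m) = x i m" if "m \<le> s i" for m
    using that by (simp add: nth_append down_list_nth)
  have "cycle_of_list ?L (?L ! (length ?U + m)) = ?L ! (Suc (length ?U + m) mod length ?L)"
    by (rule cycle_of_list_nth) (use assms distinct_lists in \<open>auto simp: length_lists\<close>)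
  moreover have "Suc (length ?U + m) < length ?L"
    using assms by (simp add: length_lists(2))
  ultimately show ?thesis
    using nth[of m] nth[of "Suc m"] assms by (simp add: nxt_eq)
qed

lemma nxt_down_last:
  assumes "i < k" "j \<le> s (Suc i)"
  shows "nxt (x (Suc i) j) (x i (s i)) =
    (if Suc i < k then x (Suc (Suc i)) (s (Suc (Suc i))) else x i 0)"
proof -
  let ?U = "up_list (Suc i)" and ?D = "down_list (Suc i)"
  let ?L = "?U @ ?D"
  have len: "length ?L = Suc (length ?U + s i)"
    by (simp add: length_lists(2))
  have "?L ! (length ?U + s i) = x i (s i)"
    by (simp add: nth_append down_list_nth)
  moreover have "cycle_of_list ?L (?L ! (length ?U + s i)) = ?L ! 0"
    using cycle_of_list_nth[of ?L "length ?U + s i"] assms distinct_lists[of "Suc i"] len by simp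
  moreover have "?L ! 0 = (if Suc i < k then x (Suc (Suc i)) (s (Suc (Suc i))) else x i 0)"
    using up_list_nth[of "Suc i" "s (Suc (Suc i))"] down_list_nth[of 0 i]
    by (auto simp: nth_append length_lists)
  ultimately show ?thesis
    using assms by (simp add: nxt_eq)
qed

lemma neighbours_subset: "neighbours v \<subseteq> pverts G"
  by (auto simp: neighbours_def arc_iff x_in)

lemma neighbours_up: "i < k \<Longrightarrow> j \<le> s i \<Longrightarrow> m \<le> s (Suc i) \<Longrightarrow> x (Suc i) m \<in> neighbours (x i j)"
  using arc by (simp add: neighbours_def)

lemma neighbours_down: "i < k \<Longrightarrow> j \<le> s (Suc i) \<Longrightarrow> m \<le> s i \<Longrightarrow> x i m \<in> neighbours (x (Suc i) j)"
  using arc by (simp add: neighbours_def)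

lemma spanning_tree_arcs:
  assumes "is_spanning_tree G T"
  shows "T \<subseteq> parcs G"
  using assms by (simp add: is_spanning_tree_def)

lemma arc_in_verts: "(u, v) \<in> parcs G \<Longrightarrow> u \<in> pverts G \<and> v \<in> pverts G"
  by (auto simp: arc_iff x_in)

lemma ribbon_tree:
  assumes "is_spanning_tree G T"
  shows "ribbon_tree (pverts G) neighbours nxt T (x 0 0) (x (Suc 0) (s (Suc 0)))"
proof
  have T: "T \<subseteq> parcs G" "und_tree \<lparr>pverts = pverts G, parcs = T\<rparr>"
    using assms by (auto simp: is_spanning_tree_def)
  then have TV: "T \<subseteq> pverts G \<times> pverts G"
    using arc_in_verts by auto
  interpret pair_digraph G
    by (rule pair_digraph_G)
  show "finite (pverts G)"
    by simp
  show "neighbours v \<subseteq> pverts G" for v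
    by (rule neighbours_subset)
  show "w \<in> neighbours v \<Longrightarrow> v \<in> neighbours w" for v w
    by (auto simp: neighbours_def)
  show irrefl: "v \<notin> neighbours v" for v
    using no_loops by (fastforce simp: neighbours_def)
  show "bij_betw (nxt v) (neighbours v) (neighbours v)" if "v \<in> pverts G" for v
    using that by (elim vertexE) (simp only: neighbours_eq nxt_eq permutes_imp_bij[OF cycle_permutes])
  show "\<exists>n. (nxt v ^^ n) y = z"
    if "v \<in> pverts G" "y \<in> neighbours v" "z \<in> neighbours v" for v y z
    using that(1)
  proof (rule vertexE)
    fix i j assume "i \<le> k" "j \<le> s i" "v = x i j"
    then show ?thesis
      using that(2,3) cycle_of_list_transitive[OF distinct_lists] by (simp only: neighbours_eq nxt_eq)
  qed
  show "u \<in> pverts G \<and> v \<in> neighbours u" if "(u, v) \<in> T" for u v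
    using that T arc_in_verts by (auto simp: neighbours_def)
  show "(u, v) \<in> (T \<union> T\<inverse>)\<^sup>*" if "u \<in> pverts G" "v \<in> pverts G" for u v
    using T(2) that connected_iff_rtrancl[OF TV] unfolding und_tree_def by blast
  show "(v, u) \<notin> (T \<union> T\<inverse> - {(u, v), (v, u)})\<^sup>*" if "(u, v) \<in> T \<union> T\<inverse>" for u v
  proof -
    have "v \<in> neighbours u"
      using that T by (auto simp: neighbours_def)
    then show ?thesis
      using und_tree_bridge[OF T(2) TV that] irrefl by metis
  qed
  show "x 0 0 \<in> pverts G"
    by (simp add: x_in)
  show "x (Suc 0) (s (Suc 0)) \<in> neighbours (x 0 0)"
    using neighbours_up[of 0 0 "s (Suc 0)"] k_pos by simp
qed

end

section \<open>Spanning trees of layer-complete graphs\<close>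

locale layered_tree = complete_layers +
  fixes T :: "('a \<times> 'a) set"
  assumes spanning: "is_spanning_tree G T"

text \<open>
  The basis is written with \<open>Suc 0\<close>, the normal form of \<open>1\<close> for the simplifier, so that facts
  about the tour still match after simplification.
\<close>

sublocale layered_tree \<subseteq> ribbon_tree "pverts G" neighbours nxt T "x 0 0" "x (Suc 0) (s (Suc 0))"
  by (rule ribbon_tree[OF spanning])

context layered_tree
begin

text \<open>
  The bounds are included because \<open>x i\<close> enumerates layer \<open>i\<close> only up to the index \<open>s i\<close> and is
  arbitrary beyond it.
\<close>

definition edge :: "nat \<Rightarrow> nat \<Rightarrow> nat \<Rightarrow> bool" where
  "edge i a b \<longleftrightarrow> i < k \<and> a \<le> s i \<and> b \<le> s (Suc i) \<and> (x i a, x (Suc i) b) \<in> T"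

lemma edge_bounds: "edge i a b \<Longrightarrow> i < k \<and> a \<le> s i \<and> b \<le> s (Suc i)"
  by (simp add: edge_def)

lemma edge_R:
  assumes "edge i a b"
  shows "(x i a, x (Suc i) b) \<in> R" "(x (Suc i) b, x i a) \<in> R"
  using assms by (auto simp: edge_def)

lemma T_edge:
  assumes "(u, v) \<in> T"
  obtains i a b where "edge i a b" "u = x i a" "v = x (Suc i) b"
proof -
  have "(u, v) \<in> parcs G"
    using spanning_tree_arcs[OF spanning] assms by blast
  then obtain i a b where "i < k" "a \<le> s i" "b \<le> s (Suc i)" "u = x i a" "v = x (Suc i) b"
    unfolding arc_iff by blast
  then show thesis
    using that[of i a b] assms by (simp add: edge_def)
qed

lemma R_edge:
  assumes "i \<le> k" "j \<le> s i" "(u, x i j) \<in> R"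
  obtains (up) b where "edge i j b" "u = x (Suc i) b"
    | (down) i' a where "i = Suc i'" "edge i' a j" "u = x i' a"
proof -
  from assms(3) consider "(x i j, u) \<in> T" | "(u, x i j) \<in> T"
    by blast
  then show thesis
  proof cases
    case 1
    then obtain i' a b where "edge i' a b" "x i j = x i' a" "u = x (Suc i') b"
      by (rule T_edge)
    then show thesis
      using up edge_bounds[of i' a b] x_eq_iff[of i j i' a] assms(1,2) by simp
  next
    case 2
    then obtain i' a b where "edge i' a b" "u = x i' a" "x i j = x (Suc i') b"
      by (rule T_edge)
    then show thesis
      using down edge_bounds[of i' a b] x_eq_iff[of i j "Suc i'" b] assms(1,2) by simp
  qed
qed

lemma non_edge_R:
  assumes "i < k" "a \<le> s i" "b \<le> s (Suc i)" "\<not> edge i a b"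
  shows "(x i a, x (Suc i) b) \<notin> R" "(x (Suc i) b, x i a) \<notin> R"
proof -
  have "(x i a, x (Suc i) b) \<notin> T"
    using assms by (simp add: edge_def)
  moreover have "(x (Suc i) b, x i a) \<notin> T"
  proof
    assume "(x (Suc i) b, x i a) \<in> T"
    then obtain i' a' b' where "edge i' a' b'" "x (Suc i) b = x i' a'" "x i a = x (Suc i') b'"
      by (rule T_edge)
    then show False
      using assms edge_bounds[of i' a' b'] x_eq_iff[of "Suc i" b i' a'] x_eq_iff[of i a "Suc i'" b']
      by simp
  qed
  ultimately show "(x i a, x (Suc i) b) \<notin> R" "(x (Suc i) b, x i a) \<notin> R"
    by blast+
qed

lemma vertex_edge:
  assumes "i \<le> k" "j \<le> s i"
  shows "(\<exists>b. edge i j b) \<or> (\<exists>i' a. i = Suc i' \<and> edge i' a j)"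
proof -
  define v where "v = (if i = 0 then x (Suc 0) 0 else x 0 0)"
  have "v \<in> pverts G"
    using x_in k_pos by (simp add: v_def)
  then have "(v, x i j) \<in> R\<^sup>*"
    using T_connected x_in[OF assms] by blast
  moreover have "v \<noteq> x i j"
    using x_eq_iff[of "Suc 0" 0 i j] x_eq_iff[of 0 0 i j] assms k_pos by (cases i) (simp_all add: v_def)
  ultimately obtain u where "(u, x i j) \<in> R"
    by (meson rtranclE)
  then show ?thesis
    using R_edge[OF assms] by metis
qed

text \<open>
  Both \<open>up i a b\<close> and \<open>down i a b\<close> refer to the edge between \<open>x i a\<close> and \<open>x (i + 1) b\<close> and take
  the index of the lower vertex first, so that the Jaeger condition compares the two at the same
  arguments.
\<close>

definition up :: "nat \<Rightarrow> nat \<Rightarrow> nat \<Rightarrow> nat" where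
  "up i a b = time (x i a, x (Suc i) b)"

definition down :: "nat \<Rightarrow> nat \<Rightarrow> nat \<Rightarrow> nat" where
  "down i a b = time (x (Suc i) b, x i a)"

lemma up_in_H: "i < k \<Longrightarrow> a \<le> s i \<Longrightarrow> b \<le> s (Suc i) \<Longrightarrow> (x i a, x (Suc i) b) \<in> H"
  using neighbours_up x_in by simp

lemma down_in_H: "i < k \<Longrightarrow> a \<le> s i \<Longrightarrow> b \<le> s (Suc i) \<Longrightarrow> (x (Suc i) b, x i a) \<in> H"
  using neighbours_down x_in by simp

text \<open>
  The pairs going up from a vertex are passed from right to left, unless the edge to the parent,
  after which the tour of the vertex starts, lies in between. The same holds in the opposite
  direction for the pairs going down.
\<close>

lemma up_decreasing:
  assumes "i < k" "m \<le> s i" "j1 < j2" "j2 \<le> s (Suc i)"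
    and "\<And>j. j1 < j \<Longrightarrow> j \<le> j2 \<Longrightarrow> \<not> par (x (Suc i) j) (x i m)"
  shows "up i m j2 < up i m j1"
  using assms(3-5)
proof (induction j2)
  case (Suc j)
  have "(x i m, x (Suc i) j) \<noteq> (x 0 0, x (Suc 0) (s (Suc 0)))"
    using assms(1,2) Suc.prems x_eq_iff[of i m 0 0] x_eq_iff[of "Suc i" j "Suc 0" "s (Suc 0)"] k_pos by auto
  moreover have "\<not> par (x (Suc i) (Suc j)) (x i m)"
    using Suc.prems by blast
  ultimately have "up i m (Suc j) < up i m j"
    using time_nxt[of "x i m" "x (Suc i) (Suc j)"] nxt_up[of i m j]
      neighbours_up[of i m "Suc j"] x_in[of i m] assms(1,2) Suc.prems
    by (simp add: up_def)
  then show ?case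
    using Suc by (cases "j1 = j") auto
qed simp

lemma down_increasing:
  assumes "i < k" "m \<le> s (Suc i)" "j1 < j2" "j2 \<le> s i"
    and "\<And>j. j1 \<le> j \<Longrightarrow> j < j2 \<Longrightarrow> \<not> par (x i j) (x (Suc i) m)"
  shows "down i j1 m < down i j2 m"
  using assms(3-5)
proof (induction j2)
  case (Suc j)
  have "(x (Suc i) m, x i (Suc j)) \<noteq> (x 0 0, x (Suc 0) (s (Suc 0)))"
    using assms(1,2) x_eq_iff[of "Suc i" m 0 0] by auto
  moreover have "\<not> par (x i j) (x (Suc i) m)"
    using Suc.prems by auto
  ultimately have "down i j m < down i (Suc j) m"
    using time_nxt[of "x (Suc i) m" "x i j"] nxt_down[of i m j]
      neighbours_down[of i m j] x_in[of "Suc i" m] assms(1,2) Suc.prems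
    by (simp add: down_def)
  then show ?case
    using Suc by (cases "j1 = j") auto
qed simp

end

section \<open>Jaeger trees\<close>

locale jaeger_layered_tree = layered_tree +
  assumes jaeger: "jaeger_tree G nxt (x 0 0, x (Suc 0) (s (Suc 0))) T"
begin

lemma up_less_down:
  assumes "i < k" "a \<le> s i" "b \<le> s (Suc i)" "\<not> edge i a b"
  shows "up i a b < down i a b"
proof -
  have "(x i a, x (Suc i) b) \<in> parcs G - T"
    using assms arc by (simp add: edge_def)
  then have "precedes (tour nxt (x 0 0, x (Suc 0) (s (Suc 0))) T) (x i a, x (Suc i) b) (x (Suc i) b, x i a)"
    using jaeger unfolding jaeger_tree_def by blast
  then show ?thesis
    using precedes_tour_iff[OF up_in_H[OF assms(1-3)] down_in_H[OF assms(1-3)]]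
    by (simp add: up_def down_def)
qed

text \<open>
  By induction, the last \<open>i\<close> pairs of the tour are \<open>(x (j + 1) 0, x j 0)\<close> for \<open>j < i\<close>, in
  decreasing order of \<open>j\<close>. The pair before them is \<open>(x (i + 1) 0, x i 0)\<close> if this edge belongs to
  the tree, and \<open>(x i 0, x (i + 1) 0)\<close> otherwise. In the second case the Jaeger condition would
  require that \<open>(x (i + 1) 0, x i 0)\<close> comes later, but all later pairs are already known.
\<close>

lemma spine:
  assumes "i < k"
  shows "edge i 0 0 \<and> down i 0 0 + Suc i = period"
  using assms
proof (induction i rule: less_induct)
  case (less i)
  let ?n = "nxt (x i 0) (x (Suc i) 0)"
  have target: "Suc (time h) + i = period" if h: "h \<in> H" "step h = (x i 0, ?n)" for h
  proof (cases i)
    case 0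
    then show ?thesis
      using time_step_basis[OF h(1)] h(2) nxt_up_first[of 0 0] less.prems by simp
  next
    case (Suc i')
    then have step: "step h = (x i 0, x i' 0)"
      using h(2) nxt_up_first[of i 0] less.prems by simp
    moreover have "x i 0 \<noteq> x 0 0"
      using x_eq_iff[of i 0 0 0] less.prems Suc by simp
    ultimately have "time (x i 0, x i' 0) = Suc (time h)"
      using time_step[OF h(1)] by simp
    then show ?thesis
      using less.IH[of i'] less.prems Suc by (simp add: down_def)
  qed
  have "edge i 0 0"
  proof (rule ccontr)
    assume nonedge: "\<not> edge i 0 0"
    then have "step (x i 0, x (Suc i) 0) = (x i 0, ?n)"
      using step_nontree[OF non_edge_R(1)] less.prems by simp
    then have "Suc (up i 0 0) + i = period"
      using target[OF up_in_H] less.prems by (simp add: up_def)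
    moreover have "up i 0 0 < down i 0 0"
      using up_less_down nonedge less.prems by simp
    moreover have "down i 0 0 < period"
      using time_less[OF down_in_H] less.prems by (simp add: down_def)
    moreover define j where "j = period - Suc (down i 0 0)"
    ultimately have j: "j < i" "down i 0 0 + Suc j = period"
      by linarith+
    then have "down i 0 0 = down j 0 0"
      using less.IH[of j] less.prems by simp
    then have "(x (Suc i) 0, x i 0) = (x (Suc j) 0, x j 0)"
      unfolding down_def using time_inj[OF down_in_H[of i 0 0] down_in_H[of j 0 0]] j(1) less.prems by simp
    then show False
      using x_eq_iff[of i 0 j 0] j(1) less.prems by simp
  qed
  moreover have "Suc (down i 0 0) + i = period"
    unfolding down_def
    using target[OF down_in_H] step_tree[OF edge_R(2)[OF \<open>edge i 0 0\<close>]] less.prems by simp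
  ultimately show ?case
    by simp
qed

lemma spine_edge: "i < k \<Longrightarrow> edge i 0 0"
  using spine by blast

lemma after_spine:
  assumes "i < k" "h \<in> H" "down i 0 0 < time h"
  obtains j where "j < i" "h = (x (Suc j) 0, x j 0)"
proof -
  \<comment> \<open>The pair at distance \<open>j + 1\<close> from the end of the tour is \<open>(x (j + 1) 0, x j 0)\<close>.\<close>
  define j where "j = period - Suc (time h)"
  have j: "time h + Suc j = period"
    using time_less[OF assms(2)] unfolding j_def by simp
  then have "j < i"
    using spine[OF assms(1)] assms(3) by linarith
  then have "time h = down j 0 0"
    using spine[of j] j assms(1) by linarith
  then have "h = (x (Suc j) 0, x j 0)"
    unfolding down_def using time_inj[OF assms(2) down_in_H] \<open>j < i\<close> assms(1) by simp
  then show thesis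
    using that \<open>j < i\<close> by blast
qed

lemma spine_par:
  assumes "i < k"
  shows "par (x i 0) (x (Suc i) 0)"
proof -
  have "\<not> par (x (Suc i) 0) (x i 0)"
  proof
    assume "par (x (Suc i) 0) (x i 0)"
    then have "down i 0 0 < time (x i 0, x (Suc i) 0)"
      by (simp add: par_def down_def)
    then obtain j where "j < i" "(x i 0, x (Suc i) 0) = (x (Suc j) 0, x j 0)"
      using after_spine[OF assms up_in_H[of i 0 0]] assms by blast
    then show False
      using x_eq_iff[of "Suc i" 0 j 0] assms by auto
  qed
  then show ?thesis
    using par_or_par[OF edge_R(1)[OF spine_edge[OF assms]]] by blast
qed

lemma not_par_spine:
  assumes "i < k" "j \<le> s (Suc i)"
  shows "\<not> par (x (Suc i) j) (x i 0)"
proof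
  assume par: "par (x (Suc i) j) (x i 0)"
  then obtain i' where i': "i = Suc i'"
    using not_par_root by (metis not0_implies_Suc)
  then have "x (Suc i) j = x i' 0"
    using par_unique[OF par] spine_par[of i'] assms by simp
  then show False
    using x_eq_iff[of "Suc i" j i' 0] i' assms by simp
qed

text \<open>
  The time at which the tour starts to look at the edges going up from \<open>x i 0\<close>.
\<close>

abbreviation \<tau> :: "nat \<Rightarrow> nat" where "\<tau> i \<equiv> up i 0 (s (Suc i))"

lemma \<tau>_le: "i < k \<Longrightarrow> j \<le> s (Suc i) \<Longrightarrow> \<tau> i \<le> up i 0 j"
  using up_decreasing[of i 0 j "s (Suc i)"] not_par_spine by (cases "j = s (Suc i)") (auto intro: less_imp_le)

lemma down_less_\<tau>:
  assumes "Suc i < k" "0 < j" "j \<le> s i"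
  shows "down i j 0 < \<tau> (Suc i)"
proof -
  have not_par: "\<not> par (x i j') (x (Suc i) 0)" if "0 < j'" "j' \<le> s i" for j'
    using par_unique[OF _ spine_par[of i]] x_eq_iff[of i j' i 0] that assms by auto
  have "down i j 0 \<le> down i (s i) 0"
    using down_increasing[of i 0 j "s i"] not_par assms by (cases "j = s i") (auto intro: less_imp_le)
  also have "\<dots> < \<tau> (Suc i)"
    using time_nxt[of "x (Suc i) 0" "x i (s i)"] nxt_down_last[of i 0] not_par[of "s i"] assms
      neighbours_down[of i 0 "s i"] x_in[of "Suc i" 0] x_eq_iff[of "Suc i" 0 0 0]
    by (simp add: down_def up_def)
  finally show ?thesis .
qed

text \<open>
  At \<open>x (i + 1) 0\<close>, the edges to layer \<open>i\<close> except the one to its parent \<open>x i 0\<close> are seen before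
  the tour turns upwards, and by the Jaeger condition they have been seen from below even earlier,
  or they are tree edges along which the tour has already returned.
\<close>

lemma up_less_\<tau>:
  assumes "Suc i < k" "t \<le> s i"
  shows "up i t 0 < \<tau> (Suc i)"
proof (cases "t = 0")
  case True
  then show ?thesis
    using par_child_times(1)[OF spine_par[of i], of "x (Suc (Suc i)) (s (Suc (Suc i)))"]
      neighbours_up[of "Suc i" 0] assms
    by (simp add: up_def)
next
  case False
  have less: "down i t 0 < \<tau> (Suc i)"
    using down_less_\<tau> assms False by simp
  show ?thesis
  proof (cases "edge i t 0")
    case True
    have "\<not> par (x i t) (x (Suc i) 0)"
      using par_unique[OF _ spine_par[of i]] x_eq_iff[of i t i 0] False assms by auto
    then have "par (x (Suc i) 0) (x i t)"
      using par_or_par[OF edge_R(1)[OF True]] by blast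
    then show ?thesis
      using par_parent_times[of "x (Suc i) 0" "x i t" "x (Suc (Suc i)) (s (Suc (Suc i)))"]
        neighbours_up[of "Suc i" 0] less assms
      by (simp add: up_def down_def)
  next
    case False
    then show ?thesis
      using up_less_down[of i t 0] less assms by simp
  qed
qed

text \<open>
  Otherwise the tour would alternate between \<open>v\<close> and \<open>x (i + 1) 0\<close>, since it comes back to \<open>x (i +
  1) 0\<close> after its last visit to \<open>v\<close>.
\<close>

lemma same_side_of_\<tau>:
  assumes i: "Suc i < k" and v: "\<And>j. j \<le> i \<Longrightarrow> v \<noteq> x (Suc j) 0"
    and H: "(v, w1) \<in> H" "(v, w2) \<in> H" and less: "time (v, w1) < \<tau> (Suc i)"
  shows "time (v, w2) < \<tau> (Suc i)"
proof (rule ccontr)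
  let ?\<sigma> = "x (Suc i) 0"
  assume "\<not> time (v, w2) < \<tau> (Suc i)"
  moreover have up_H: "(?\<sigma>, x (Suc (Suc i)) (s (Suc (Suc i)))) \<in> H"
    using up_in_H[of "Suc i" 0 "s (Suc (Suc i))"] i by simp
  then have "time (v, w2) \<noteq> \<tau> (Suc i)"
    using time_inj[OF H(2) up_H] v[of i] unfolding up_def by auto
  ultimately have 2: "\<tau> (Suc i) < time (v, w2)"
    by simp
  have "time (v, w2) \<noteq> down i 0 0"
    using time_inj[OF H(2) down_in_H[of i 0 0]] v[of i] i unfolding down_def by auto
  moreover have "\<not> down i 0 0 < time (v, w2)"
    using after_spine[OF _ H(2)] v i by (metis Suc_lessD less_imp_le prod.inject)
  ultimately have 3: "time (v, w2) < time (?\<sigma>, x i 0)"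
    by (simp add: down_def)
  show False
    using no_alternation[of v v ?\<sigma> ?\<sigma>, OF _ _ _ H(1) up_H H(2) down_in_H[of i 0 0]]
      less 2 3 v[of i] i unfolding up_def by simp
qed

text \<open>
  The edge from \<open>x (i + 1) 0\<close> to a vertex two layers above layer \<open>i\<close> is seen first from \<open>x (i + 1)
  0\<close>, at time \<open>\<tau> (i + 1)\<close> or later. So some pair at the upper vertex comes after \<open>\<tau> (i + 1)\<close>, and
  then all of them do.
\<close>

lemma \<tau>_less:
  assumes i: "Suc i < k" and y: "y \<le> s (Suc (Suc i))" and w: "w \<in> neighbours (x (Suc (Suc i)) y)"
  shows "\<tau> (Suc i) < time (x (Suc (Suc i)) y, w)"
proof (rule ccontr)
  let ?v = "x (Suc (Suc i)) y"
  have v: "?v \<noteq> x (Suc j) 0" if "j \<le> i" for j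
    using x_eq_iff[of "Suc (Suc i)" y "Suc j" 0] i y that by simp
  assume "\<not> \<tau> (Suc i) < time (?v, w)"
  moreover have H: "(?v, w) \<in> H"
    using w x_in[of "Suc (Suc i)" y] i y by simp
  then have "time (?v, w) \<noteq> \<tau> (Suc i)"
    using time_inj[OF H up_in_H[of "Suc i" 0 "s (Suc (Suc i))"]] v[of i] i unfolding up_def by auto
  ultimately have "time (?v, w) < \<tau> (Suc i)"
    by simp
  then have "down (Suc i) 0 y < \<tau> (Suc i)"
    using same_side_of_\<tau>[OF i v H down_in_H[of "Suc i" 0 y]] i y unfolding down_def by simp
  moreover have "up (Suc i) 0 y < down (Suc i) 0 y"
  proof (cases "edge (Suc i) 0 y")
    case True
    then have "par (x (Suc i) 0) ?v"
      using par_or_par[OF edge_R(1)[OF True]] not_par_spine[OF i y] by blast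
    then show ?thesis
      by (simp add: par_def up_def down_def)
  qed (use up_less_down i y in simp)
  moreover have "\<tau> (Suc i) \<le> up (Suc i) 0 y"
    using \<tau>_le i y by simp
  ultimately show False
    by simp
qed

text \<open>
  Suppose that the vertex \<open>v\<close> in layer \<open>i + 1\<close> is off the spine. Its pair with the tree edge
  upwards comes after \<open>\<tau> (i + 1)\<close>, since the tour continues with a pair two layers above layer
  \<open>i\<close>. Its pair with the tree edge downwards comes before \<open>\<tau> (i + 1)\<close>: either the tour continues
  with a pair at a vertex off the spine in layer \<open>i\<close>, or the edge leads to \<open>x i 0\<close>, where it lies
  to the right of the spine edge and has been used up before the tour goes on to \<open>x (i + 1) 0\<close>.
  This contradicts \<open>same_side_of_\<tau>\<close>.
\<close>

lemma one_sided:
  assumes "edge i a j" "edge (Suc i) j b"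
  shows "j = 0"
proof (rule ccontr)
  assume "j \<noteq> 0"
  let ?v = "x (Suc i) j"
  have bounds: "Suc i < k" "a \<le> s i" "j \<le> s (Suc i)" "b \<le> s (Suc (Suc i))"
    using assms edge_bounds by blast+
  have v: "?v \<noteq> x (Suc j') 0" if "j' \<le> i" for j'
    using x_eq_iff[of "Suc i" j "Suc j'" 0] bounds that \<open>j \<noteq> 0\<close> by simp
  have down: "down i a j < \<tau> (Suc i)"
  proof (cases "a = 0")
    case True
    then have par: "par (x i 0) ?v"
      using par_or_par[OF edge_R(1)[OF assms(1)]] not_par_spine bounds by auto
    have "up i 0 j < up i 0 0"
      using up_decreasing[of i 0 0 j] not_par_spine bounds \<open>j \<noteq> 0\<close> by simp
    then have "down i 0 j < up i 0 0"
      using par_parent_times[OF par] neighbours_up[of i 0 0] bounds unfolding up_def down_def by simp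
    then show ?thesis
      using up_less_\<tau>[of i 0] bounds True by simp
  next
    case False
    let ?u = "x i a"
    have u: "?u \<noteq> x (Suc j') 0" if "j' \<le> i" for j'
      using x_eq_iff[of i a "Suc j'" 0] bounds that False by simp
    have H: "(?u, nxt ?u ?v) \<in> H"
      using nxt_in x_in[of i a] neighbours_up[of i a j] bounds by simp
    have "time (?u, nxt ?u ?v) < \<tau> (Suc i)"
      using same_side_of_\<tau>[OF _ u up_in_H[of i a 0] H] up_less_\<tau>[of i a] bounds
      unfolding up_def by simp
    moreover have "(?u, nxt ?u ?v) \<noteq> (x 0 0, x (Suc 0) (s (Suc 0)))"
      using x_eq_iff[of i a 0 0] False bounds by simp
    then have "time (?u, nxt ?u ?v) = Suc (down i a j)"
      using time_across[OF edge_R(2)[OF assms(1)]] by (simp add: down_def)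
    ultimately show ?thesis
      by simp
  qed
  let ?w = "x (Suc (Suc i)) b"
  have "\<tau> (Suc i) \<le> up (Suc i) j b"
  proof -
    have nw: "nxt ?w ?v \<in> neighbours ?w"
      using nxt_in x_in[of "Suc (Suc i)" b] neighbours_down[of "Suc i" b j] bounds by simp
    have "?w \<noteq> x 0 0"
      using x_eq_iff[of "Suc (Suc i)" b 0 0] bounds by simp
    then have "time (?w, nxt ?w ?v) = Suc (up (Suc i) j b)"
      using time_across[OF edge_R(1)[OF assms(2)]] by (simp add: up_def)
    then show ?thesis
      using \<tau>_less[OF bounds(1,4) nw] by simp
  qed
  moreover have "up (Suc i) j b < \<tau> (Suc i)"
    using same_side_of_\<tau>[OF bounds(1) v down_in_H[of i a j] up_in_H[of "Suc i" j b]] down bounds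
    unfolding up_def down_def by simp
  ultimately show False
    by simp
qed

text \<open>
  As a vertex off the spine has tree edges in one direction only, its parent lies in the same
  direction as any of its tree neighbours.
\<close>

lemma parent_below:
  assumes "edge i a m"
  obtains c where "par (x i c) (x (Suc i) m)" "edge i c m"
proof (cases "m = 0")
  case True
  then show thesis
    using that[of 0] spine_par spine_edge edge_bounds[OF assms] by simp
next
  case False
  have bounds: "i < k" "m \<le> s (Suc i)"
    using edge_bounds[OF assms] by auto
  obtain p where p: "par p (x (Suc i) m)"
    using exists_par[of "x (Suc i) m"] x_in[of "Suc i" m] x_eq_iff[of "Suc i" m 0 0] bounds by auto
  then have "(p, x (Suc i) m) \<in> R"
    by (simp add: par_def)
  then show thesis
  proof (rule R_edge[rotated 2])
    fix b assume "edge (Suc i) m b"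
    then show thesis
      using one_sided[OF assms] False by blast
  next
    fix i' c assume "Suc i = Suc i'" "edge i' c m" "p = x i' c"
    then show thesis
      using that p by simp
  qed (use bounds in auto)
qed

lemma parent_above:
  assumes "edge i a m" "a \<noteq> 0"
  obtains c where "par (x (Suc i) c) (x i a)" "edge i a c"
proof -
  have bounds: "i < k" "a \<le> s i"
    using edge_bounds[OF assms(1)] by auto
  obtain p where p: "par p (x i a)"
    using exists_par[of "x i a"] x_in[of i a] x_eq_iff[of i a 0 0] bounds assms(2) by auto
  then have "(p, x i a) \<in> R"
    by (simp add: par_def)
  then show thesis
  proof (rule R_edge[rotated 2])
    fix b assume "edge i a b" "p = x (Suc i) b"
    then show thesis
      using that p by simp
  next
    fix i' c assume "i = Suc i'" "edge i' c a"
    then show thesis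
      using one_sided[of i' c a m] assms by simp
  qed (use bounds in auto)
qed

text \<open>
  Let \<open>w\<close> be the parent of \<open>x i j'\<close> and \<open>x i c\<close> the parent of \<open>w\<close>. The pairs from \<open>w\<close> down to
  layer \<open>i\<close> are passed cyclically from left to right, starting to the right of \<open>c\<close>. Unless \<open>j \<le> c
  < j'\<close>, the edge between \<open>w\<close> and \<open>x i j\<close> is therefore seen from \<open>w\<close> before \<open>x i j'\<close> is entered,
  and at that time either it was seen from \<open>x i j\<close> before or the tour follows it to \<open>x i j\<close>. If \<open>j
  \<le> c < j'\<close>, the vertex \<open>x i c\<close> is entered before its grandchild \<open>x i j'\<close>, and the claim for \<open>c\<close>
  in place of \<open>j'\<close> is available by induction.
\<close>

lemma first_time_increasing:
  "edge i j' m \<Longrightarrow> j < j' \<Longrightarrow> first_time (x i j) < first_time (x i j')"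
proof (induction j' arbitrary: j m rule: less_induct)
  case (less j')
  obtain m' where m': "par (x (Suc i) m') (x i j')" "edge i j' m'"
    using parent_above[OF less.prems(1)] less.prems(2) by auto
  obtain c where c: "par (x i c) (x (Suc i) m')" "edge i c m'"
    using parent_below[OF m'(2)] by blast
  have bounds: "i < k" "j' \<le> s i" "j \<le> s i" "c \<le> s i" "m' \<le> s (Suc i)"
    using edge_bounds m' c less.prems(2) by force+
  have first_time_j': "first_time (x i j') = Suc (down i j' m')"
    using first_time_par[OF m'(1)] by (simp add: down_def)
  have "c \<noteq> j'"
    using m'(1) c(1) by (auto simp: par_def)
  show ?case
  proof (cases "j \<le> c \<and> c < j'")
    case True
    have "first_time (x i c) \<le> up i c m'"
      using first_time_le[OF up_in_H] bounds by (simp add: up_def)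
    also have "\<dots> < down i j' m'"
      using par_child_times(1)[OF c(1)] neighbours_down bounds by (simp add: up_def down_def)
    finally have "first_time (x i c) < first_time (x i j')"
      using first_time_j' by simp
    moreover have "first_time (x i j) \<le> first_time (x i c)"
      using less.IH[of c m' j] True c(2) by (cases "j = c") (auto intro: less_imp_le)
    ultimately show ?thesis
      by simp
  next
    case False
    have "down i j m' < down i j' m'"
    proof (rule down_increasing)
      fix a assume "j \<le> a" "a < j'"
      then have "a \<noteq> c" "a \<le> s i"
        using False bounds by auto
      then show "\<not> par (x i a) (x (Suc i) m')"
        using par_unique[OF _ c(1)] x_eq_iff[of i a i c] bounds by auto
    qed (use bounds less.prems in auto)
    moreover have "first_time (x i j) \<le> Suc (down i j m')"
    proof (cases "par (x (Suc i) m') (x i j)")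
      case True
      then show ?thesis
        using first_time_par[OF True] by (simp add: down_def)
    next
      case False
      then have "up i j m' < down i j m'"
        using up_less_down[of i j m'] par_or_par[OF edge_R(1)[of i j m']] bounds
        by (auto simp: par_def up_def down_def)
      then show ?thesis
        using first_time_le[OF up_in_H[of i j m']] bounds by (simp add: up_def)
    qed
    ultimately show ?thesis
      using first_time_j' by simp
  qed
qed

lemma up_less_last:
  assumes "i < k" "a \<le> s i" "b \<le> s (Suc i)"
  shows "up i a b < last_time (x (Suc i) b)"
proof (cases "edge i a b")
  case True
  let ?v = "x (Suc i) b"
  have H: "(?v, nxt ?v (x i a)) \<in> H"
    using nxt_in x_in[of "Suc i" b] neighbours_down assms by simp
  have "?v \<noteq> x 0 0"
    using x_eq_iff[of "Suc i" b 0 0] assms by simp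
  then show ?thesis
    using time_across[OF edge_R(1)[OF True]] le_last_time[OF H] by (simp add: up_def)
next
  case False
  then show ?thesis
    using up_less_down[OF assms] le_last_time[OF down_in_H[OF assms]] by (simp add: down_def)
qed

text \<open>
  Reversing time and exchanging the roles of the two layers turns this into
  \<open>first_time_increasing\<close>, and the proofs correspond to each other.
\<close>

lemma last_time_decreasing:
  "edge i m j' \<Longrightarrow> j < j' \<Longrightarrow> last_time (x (Suc i) j') < last_time (x (Suc i) j)"
proof (induction j' arbitrary: j m rule: less_induct)
  case (less j')
  obtain p where p: "par (x i p) (x (Suc i) j')" "edge i p j'"
    using parent_below[OF less.prems(1)] by blast
  have bounds: "i < k" "p \<le> s i" "j' \<le> s (Suc i)" "j \<le> s (Suc i)"
    using edge_bounds[OF p(2)] less.prems(2) by auto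
  have after: "last_time (x (Suc i) j') < last_time (x (Suc i) c)" if "c \<le> s (Suc i)" "up i p j' < up i p c" for c
  proof -
    have "last_time (x (Suc i) j') = down i p j'"
      using last_time_par[OF p(1)] by (simp add: down_def)
    also have "\<dots> < up i p c"
      using par_parent_times[OF p(1)] neighbours_up[of i p c] that bounds by (simp add: up_def down_def)
    also have "\<dots> < last_time (x (Suc i) c)"
      using up_less_last that bounds by simp
    finally show ?thesis .
  qed
  show ?case
  proof (cases "\<exists>c. j < c \<and> c \<le> j' \<and> par (x (Suc i) c) (x i p)")
    case False
    then show ?thesis
      using up_decreasing[of i p j j'] after[of j] bounds less.prems(2) by blast
  next
    case True
    then obtain c where c: "j < c" "c \<le> j'" "par (x (Suc i) c) (x i p)"
      by blast
    have "c \<noteq> j'"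
      using p(1) c(3) by (auto simp: par_def)
    have "edge i p c"
    proof (rule ccontr)
      assume "\<not> edge i p c"
      then show False
        using non_edge_R[of i p c] c bounds by (simp add: par_def)
    qed
    then have "last_time (x (Suc i) c) < last_time (x (Suc i) j)"
      using less.IH[of c p j] c \<open>c \<noteq> j'\<close> by simp
    moreover have "up i p j' \<le> up i p c"
      using par_child_times(2)[OF c(3)] neighbours_up[of i p j'] bounds by (simp add: up_def)
    moreover have "up i p j' \<noteq> up i p c"
      using time_inj[OF up_in_H[of i p j'] up_in_H[of i p c]] x_eq_iff[of "Suc i" j' "Suc i" c]
        \<open>c \<noteq> j'\<close> c(2) bounds by (auto simp: up_def)
    ultimately show ?thesis
      using after[of c] c(2) bounds by simp
  qed
qed

text \<open>
  The tour would first enter \<open>x i a\<close>, then \<open>x i a'\<close>, and then leave \<open>x (i + 1) b'\<close> for the last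
  time before it leaves \<open>x (i + 1) b\<close> for the last time. This alternates between two disjoint tree
  edges.
\<close>

lemma no_crossing:
  assumes "edge i a b'" "edge i a' b" "a < a'"
  shows "b' \<le> b"
proof (rule ccontr)
  assume "\<not> b' \<le> b"
  have bounds: "i < k" "a \<le> s i" "a' \<le> s i" "b \<le> s (Suc i)" "b' \<le> s (Suc i)"
    using assms edge_bounds by blast+
  have "first_time (x i a) < first_time (x i a')"
    using first_time_increasing assms by blast
  moreover have "first_time (x i a') < last_time (x (Suc i) b')"
    using first_time_le[OF up_in_H[of i a' b']] up_less_last[of i a' b'] bounds by (simp add: up_def)
  moreover have "last_time (x (Suc i) b') < last_time (x (Suc i) b)"
    using last_time_decreasing[OF assms(1)] \<open>\<not> b' \<le> b\<close> by simp
  moreover obtain w1 where "(x i a, w1) \<in> H" "time (x i a, w1) = first_time (x i a)"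
    using first_time_attained[OF up_in_H[of i a b]] bounds by blast
  moreover obtain w2 where "(x i a', w2) \<in> H" "time (x i a', w2) = first_time (x i a')"
    using first_time_attained[OF up_in_H[of i a' b]] bounds by blast
  moreover obtain w3 where "(x (Suc i) b', w3) \<in> H" "time (x (Suc i) b', w3) = last_time (x (Suc i) b')"
    using last_time_attained[OF down_in_H[of i a b']] bounds by blast
  moreover obtain w4 where "(x (Suc i) b, w4) \<in> H" "time (x (Suc i) b, w4) = last_time (x (Suc i) b)"
    using last_time_attained[OF down_in_H[of i a b]] bounds by blast
  moreover have "{x i a, x (Suc i) b'} \<inter> {x i a', x (Suc i) b} = {}"
    using bounds \<open>a < a'\<close> \<open>\<not> b' \<le> b\<close> by (auto simp: x_eq_iff)
  ultimately show False
    using no_alternation[OF disjI1[OF edge_R(1)[OF assms(1)]] disjI1[OF edge_R(1)[OF assms(2)]],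
        of w1 w2 w3 w4] by simp
qed

end

section \<open>The tour of a tree with spine, one-sided vertices and no crossings\<close>

text \<open>
  The description of the trees that mediates between Jaeger trees and comb-trees. In terms of the
  drawing, the tree edges between two layers form a staircase.
\<close>

locale comb_layered_tree = layered_tree +
  assumes spine_edge: "i < k \<Longrightarrow> edge i 0 0"
    and one_sided: "edge i a j \<Longrightarrow> edge (Suc i) j b \<Longrightarrow> j = 0"
    and no_crossing: "edge i a b' \<Longrightarrow> edge i a' b \<Longrightarrow> a < a' \<Longrightarrow> b' \<le> b"
begin

definition min_up :: "nat \<Rightarrow> nat \<Rightarrow> nat" where
  "min_up i a = Min {b. edge i a b}"

definition max_up :: "nat \<Rightarrow> nat \<Rightarrow> nat" where
  "max_up i a = Max {b. edge i a b}"

definition min_down :: "nat \<Rightarrow> nat \<Rightarrow> nat" where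
  "min_down i b = Min {a. edge i a b}"

definition max_down :: "nat \<Rightarrow> nat \<Rightarrow> nat" where
  "max_down i b = Max {a. edge i a b}"

lemma finite_edges: "finite {b. edge i a b}" "finite {a. edge i a b}"
  using edge_bounds
  by (auto intro!: finite_subset[of _ "{..s (Suc i)}"] finite_subset[of "{a. edge i a b}" "{..s i}"])

lemma min_max_edge:
  assumes "edge i a b"
  shows "edge i a (min_up i a)" "edge i a (max_up i a)"
    "edge i (min_down i b) b" "edge i (max_down i b) b"
  using assms finite_edges Min_in[of "{b. edge i a b}"] Max_in[of "{b. edge i a b}"]
    Min_in[of "{a. edge i a b}"] Max_in[of "{a. edge i a b}"]
  unfolding min_up_def max_up_def min_down_def max_down_def by blast+

lemma min_max_le:
  assumes "edge i a b"
  shows "min_up i a \<le> b" "b \<le> max_up i a" "min_down i b \<le> a" "a \<le> max_down i b"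
  using assms finite_edges unfolding min_up_def max_up_def min_down_def max_down_def by auto

lemma min_max_bounds:
  assumes "edge i a b"
  shows "min_up i a \<le> max_up i a" "max_up i a \<le> s (Suc i)"
    "min_down i b \<le> max_down i b" "max_down i b \<le> s i"
  using min_max_le[OF assms] edge_bounds[OF min_max_edge(2)[OF assms]]
    edge_bounds[OF min_max_edge(4)[OF assms]] by linarith+

text \<open>
  If \<open>x i a\<close> has a tree neighbour to the right of \<open>b\<close>, an edge from \<open>b\<close> to a vertex to the right
  of \<open>a\<close> would cross the edge to this neighbour.
\<close>

lemma max_down_eq:
  assumes "edge i a b" "b < max_up i a"
  shows "max_down i b = a"
proof -
  have "\<not> a < max_down i b"
    using no_crossing[OF min_max_edge(2,4)[OF assms(1)]] assms(2) by (metis not_le)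
  then show ?thesis
    using min_max_le(4)[OF assms(1)] by simp
qed

lemma min_up_eq:
  assumes "edge i a b" "min_down i b < a"
  shows "min_up i a = b"
  using no_crossing[OF min_max_edge(3,1)[OF assms(1)] assms(2)] min_max_le(1)[OF assms(1)] by simp

text \<open>
  No edge of the row starts strictly to the left and ends weakly to the right of the edge \<open>ab\<close>,
  nor conversely. If \<open>ab\<close> were not the spine edge, the vertices of the row from \<open>a\<close> and from \<open>b\<close>
  on would be off the spine, so by one-sidedness they would be cut off from the rest of the tree.
\<close>

lemma leftmost_edge:
  assumes "edge i a b" "min_up i a = b" "min_down i b = a"
  shows "b = 0"
proof (rule ccontr)
  assume "b \<noteq> 0"
  have i: "i < k" "a \<le> s i" "b \<le> s (Suc i)"
    using edge_bounds[OF assms(1)] by auto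
  have "a \<noteq> 0"
    using min_max_le(1)[OF spine_edge[OF i(1)]] assms(2) \<open>b \<noteq> 0\<close> by (metis le_zero_eq)
  \<comment> \<open>\<open>Z\<close> is closed under adjacency in the tree, but does not contain the root.\<close>
  define Z where "Z = {x i a' | a' b'. a \<le> a' \<and> edge i a' b'} \<union> {x (Suc i) b' | a' b'. b \<le> b' \<and> edge i a' b'}"
  have closed: "w \<in> Z" if "u \<in> Z" "(w, u) \<in> R" for u w
  proof -
    from \<open>u \<in> Z\<close> consider a' b' where "a \<le> a'" "edge i a' b'" "u = x i a'"
      | a' b' where "b \<le> b'" "edge i a' b'" "u = x (Suc i) b'"
      unfolding Z_def by blast
    then show ?thesis
    proof cases
      case 1
      have "i \<le> k" "a' \<le> s i" "(w, x i a') \<in> R"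
        using edge_bounds[OF 1(2)] that 1 by auto
      then show ?thesis
      proof (cases rule: R_edge)
        case (up c)
        have "b \<le> c"
          using no_crossing[OF assms(1) up(1)] min_max_le(1)[OF up(1)] assms(2) \<open>a \<le> a'\<close>
          by (cases "a = a'") auto
        then show ?thesis
          using up unfolding Z_def by blast
      next
        case (down i' c)
        then show ?thesis
          using one_sided[of i' c a' b'] 1 \<open>a \<noteq> 0\<close> by simp
      qed
    next
      case 2
      have "Suc i \<le> k" "b' \<le> s (Suc i)" "(w, x (Suc i) b') \<in> R"
        using edge_bounds[OF 2(2)] that 2 by auto
      then show ?thesis
      proof (cases rule: R_edge)
        case (up c)
        then show ?thesis
          using one_sided[OF 2(2) up(1)] 2(1) \<open>b \<noteq> 0\<close> by simp
      next
        case (down i' c)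
        then have c: "edge i c b'" "w = x i c"
          by auto
        have "a \<le> c"
          using no_crossing[OF c(1) assms(1)] min_max_le(3)[OF c(1)] assms(3) \<open>b \<le> b'\<close>
          by (metis antisym not_le)
        then show ?thesis
          using c unfolding Z_def by blast
      qed
    qed
  qed
  have "x i a \<in> Z"
    using assms(1) unfolding Z_def by blast
  have "(x 0 0, x i a) \<in> R\<^sup>*"
    using T_connected x_in i by simp
  then have "x 0 0 \<in> Z"
    by (induction rule: converse_rtrancl_induct) (fact \<open>x i a \<in> Z\<close>, rule closed)
  then consider a' b' where "a \<le> a'" "edge i a' b'" "x 0 0 = x i a'"
    | a' b' where "b \<le> b'" "edge i a' b'" "x 0 0 = x (Suc i) b'"
    unfolding Z_def by blast
  then show False
  proof cases
    case 1
    then show False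
      using x_eq_iff[of 0 0 i a'] edge_bounds[OF 1(2)] \<open>a \<noteq> 0\<close> by simp
  next
    case 2
    then show False
      using x_eq_iff[of 0 0 "Suc i" b'] edge_bounds[OF 2(2)] by simp
  qed
qed

text \<open>
  The keys describe when the tour passes the pairs \<open>(x i j, x (i + 1) m)\<close> and \<open>(x (i + 1) j, x i
  m)\<close>. The first entry is the row whose tour contains the pair, where row \<open>i\<close> is the part between
  the layers \<open>i\<close> and \<open>i + 1\<close>. Each row is traversed in two phases, given by the second entry: on
  the way out, phase 0, the lower vertices are visited from left to right, and on the way back,
  phase 1, the upper vertices are visited from right to left. The third entry is the index of the
  visited vertex, negated in phase 1. The last two entries order the pairs of one visit, and \<open>-1\<close>
  marks the pairs that lead to the visited vertex or, if their edge is not in the tree, pass it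
  by. A vertex off the spine sees all its edges, also those in the row to which none of its tree
  edges belong, during its visit in the row of its tree edges. This explains the two outermost
  \<open>else\<close> branches. The remaining pairs \<open>(x (i + 1) 0, x i 0)\<close> come after all rows.
\<close>

definition up_key :: "nat \<Rightarrow> nat \<Rightarrow> nat \<Rightarrow> int list" where
  "up_key i j m =
    (if \<exists>b. edge i j b
     then if m < min_up i j then [int i, 0, int j, 0, - int m]
       else if m < max_up i j then [int i, 1, - int m, -1, 0]
       else [int i, 0, int j, 2, - int m]
     else [int i - 1, 1, - int j, 1, - int m])"

definition down_key :: "nat \<Rightarrow> nat \<Rightarrow> nat \<Rightarrow> int list" where
  "down_key i j m =
    (if \<exists>a. edge i a j
     then if j = 0 \<and> m = 0 then [int k, - int i]
       else if m \<le> min_down i j then [int i, 1, - int j, 2, int m]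
       else if m \<le> max_down i j then [int i, 0, int m, -1, 0]
       else [int i, 1, - int j, 0, int m]
     else [int i + 1, 0, int j, 1, int m])"

lemma nonspine_edges:
  assumes "i < k" "j \<le> s (Suc i)" "j \<noteq> 0"
  shows "(\<exists>a. edge i a j) \<longleftrightarrow> \<not> (\<exists>b. edge (Suc i) j b)"
  using vertex_edge[of "Suc i" j] one_sided assms by (metis Suc_leI nat.inject)

lemma bottom_edges: "j \<le> s 0 \<Longrightarrow> \<exists>b. edge 0 j b"
  using vertex_edge[of 0 j] by simp

lemma top_edges: "Suc i = k \<Longrightarrow> j \<le> s (Suc i) \<Longrightarrow> \<exists>a. edge i a j"
  using vertex_edge[of "Suc i" j] edge_bounds by fastforce

lemma key_up_Suc:
  assumes "i < k" "j \<le> s i" "Suc m \<le> s (Suc i)" "\<not> edge i j (Suc m)"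
  shows "up_key i j (Suc m) < up_key i j m"
proof (cases "\<exists>b. edge i j b")
  case True
  then obtain b where b: "edge i j b"
    by blast
  have "Suc m \<noteq> min_up i j" "Suc m \<noteq> max_up i j"
    using min_max_edge[OF b] assms(4) by auto
  then show ?thesis
    using True min_max_bounds[OF b] by (auto simp: up_key_def)
qed (simp add: up_key_def)

lemma key_up_0_bottom:
  assumes "j \<le> s 0" "\<not> edge 0 j 0"
  shows "up_key 0 j 0 < up_key 0 j (s (Suc 0))"
proof -
  obtain b where b: "edge 0 j b"
    using bottom_edges assms by blast
  have "min_up 0 j \<noteq> 0"
    using min_max_edge[OF b] assms(2) by metis
  then show ?thesis
    using b min_max_bounds[OF b] by (auto simp: up_key_def)
qed

lemma key_up_0:
  assumes "Suc i < k" "j \<le> s (Suc i)" "\<not> edge (Suc i) j 0"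
  shows "up_key (Suc i) j 0 < down_key i j 0"
proof -
  have "j \<noteq> 0"
    using spine_edge assms by metis
  show ?thesis
  proof (cases "\<exists>b. edge (Suc i) j b")
    case True
    then obtain b where b: "edge (Suc i) j b"
      by blast
    have "min_up (Suc i) j \<noteq> 0"
      using min_max_edge[OF b] assms(3) by metis
    then show ?thesis
      using True nonspine_edges[of i j] assms \<open>j \<noteq> 0\<close> by (auto simp: up_key_def down_key_def)
  next
    case False
    then show ?thesis
      using nonspine_edges[of i j] assms \<open>j \<noteq> 0\<close> by (auto simp: up_key_def down_key_def)
  qed
qed

lemma key_edge_up:
  assumes "edge i j m" "Suc j \<le> s i"
  shows "up_key i j m < down_key i m (Suc j)"
  using assms min_max_le[OF assms(1)] max_down_eq[OF assms(1)]
  by (auto simp: up_key_def down_key_def)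

lemma up_key_le_phase1:
  assumes "edge i j m"
  shows "up_key i j m < [int i, 1, - int m, 0]"
  using assms min_max_le[OF assms] by (auto simp: up_key_def)

lemma phase1_less_up_key:
  assumes "edge i j m" "Suc i < k"
  shows "[int i, 1, - int m, 0, int n] < up_key (Suc i) m n'"
  by (auto simp: up_key_def)

lemma phase1_less_down_key:
  assumes "edge i j m"
  shows "[int i, 1, - int m, 0, int n] < down_key i m 0"
  using assms edge_bounds[OF assms] by (auto simp: down_key_def)

lemma key_down_Suc:
  assumes "i < k" "j \<le> s (Suc i)" "Suc m \<le> s i" "\<not> edge i m j"
  shows "down_key i j m < down_key i j (Suc m)"
proof (cases "\<exists>a. edge i a j")
  case True
  then obtain a where a: "edge i a j"
    by blast
  have "m \<noteq> min_down i j" "m \<noteq> max_down i j"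
    using min_max_edge[OF a] assms(4) by auto
  moreover have "\<not> (j = 0 \<and> m = 0)"
    using spine_edge[OF assms(1)] assms by metis
  ultimately show ?thesis
    using True min_max_bounds[OF a] by (auto simp: down_key_def)
qed (simp add: down_key_def)

lemma down_key_last:
  assumes "i < k" "j \<le> s (Suc i)" "\<not> edge i (s i) j" "\<exists>a. edge i a j"
  shows "down_key i j (s i) = [int i, 1, - int j, 0, int (s i)]"
proof -
  obtain a where a: "edge i a j"
    using assms by blast
  have "s i \<noteq> max_down i j"
    using min_max_edge[OF a] assms(3) by auto
  moreover have "\<not> (j = 0 \<and> s i = 0)"
    using spine_edge[OF assms(1)] assms by metis
  ultimately show ?thesis
    using a min_max_bounds[OF a] by (auto simp: down_key_def)
qed

lemma key_down_last_up:
  assumes "Suc i < k" "j \<le> s (Suc i)" "\<not> edge i (s i) j"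
  shows "down_key i j (s i) < up_key (Suc i) j (s (Suc (Suc i)))"
proof (cases "\<exists>a. edge i a j")
  case True
  then show ?thesis
    using down_key_last assms phase1_less_up_key by (metis Suc_lessD)
next
  case False
  then have "j \<noteq> 0"
    using spine_edge assms by (metis Suc_lessD)
  then obtain b where b: "edge (Suc i) j b"
    using False nonspine_edges[of i j] assms by auto
  then show ?thesis
    using False min_max_bounds[OF b] by (auto simp: up_key_def down_key_def)
qed

text \<open>
  If the edge is not the leftmost one at its upper end, it leads to a visit of the lower vertex in
  phase 0. Otherwise it is not the leftmost one at its lower end, by \<open>leftmost_edge\<close>, so that the
  way back continues at this end with the upper vertices to the left.
\<close>

lemma key_edge_down:
  assumes "edge i m (Suc j)"
  shows "down_key i (Suc j) m < up_key i m j"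
proof (cases "min_down i (Suc j) < m")
  case True
  then show ?thesis
    using assms min_max_le[OF assms] min_up_eq[OF assms] by (auto simp: up_key_def down_key_def)
next
  case False
  then have "min_up i m \<noteq> Suc j"
    using leftmost_edge[OF assms] min_max_le[OF assms] by auto
  then show ?thesis
    using assms False min_max_le[OF assms] by (auto simp: up_key_def down_key_def)
qed

lemma min_down_0:
  assumes "i < k"
  shows "min_down i 0 = 0"
  using min_max_le(3)[OF spine_edge[OF assms]] by simp

lemma key_edge_down_0_bottom:
  assumes "edge 0 m 0" "m \<noteq> 0"
  shows "down_key 0 0 m < up_key 0 m (s (Suc 0))"
  using assms min_max_bounds[OF assms(1)] min_max_le[OF assms(1)] min_down_0[of 0] k_pos
  by (auto simp: up_key_def down_key_def)

lemma key_edge_down_0: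
  assumes "edge (Suc i) m 0"
  shows "down_key (Suc i) 0 m < down_key i m 0"
proof (cases "m = 0")
  case True
  then show ?thesis
    using assms spine_edge[of i] edge_bounds[OF assms] by (auto simp: down_key_def)
next
  case False
  then show ?thesis
    using assms min_max_le[OF assms] nonspine_edges[of i m] edge_bounds[OF assms] min_down_0[of "Suc i"]
    by (auto simp: down_key_def)
qed

text \<open>
  The only critical case is that both keys belong to the same row and the pair from above is
  passed in phase 0, so that \<open>a\<close> lies strictly between two tree neighbours of \<open>b\<close>. But then every
  edge going up from \<open>a\<close>, other than \<open>ab\<close>, crosses an edge at \<open>b\<close>.
\<close>

lemma up_key_less_down_key:
  assumes "i < k" "a \<le> s i" "b \<le> s (Suc i)" "\<not> edge i a b"
  shows "up_key i a b < down_key i b a"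
proof (cases "(\<exists>b'. edge i a b') \<and> (\<exists>a'. edge i a' b)")
  case True
  then obtain b' a' where e: "edge i a b'" "edge i a' b"
    by blast
  note e_ends = min_max_edge(1,2)[OF e(1)] min_max_edge(3,4)[OF e(2)]
  have ne: "b \<noteq> min_up i a" "b \<noteq> max_up i a" "a \<noteq> min_down i b" "a \<noteq> max_down i b"
    using e_ends assms(4) by auto
  have "min_up i a \<le> b" if "a < max_down i b"
    using no_crossing[OF e_ends(1,4)] that .
  moreover have "max_up i a \<le> b" if "a < max_down i b"
    using no_crossing[OF e_ends(2,4)] that .
  moreover have "b \<le> max_up i a" if "min_down i b < a"
    using no_crossing[OF e_ends(3,2)] that .
  ultimately show ?thesis
    using True ne min_max_bounds[OF e(1)] min_max_bounds[OF e(2)] assms(1)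
    by (auto simp: up_key_def down_key_def)
next
  case False
  then show ?thesis
    using assms(1) by (auto simp: up_key_def down_key_def)
qed

definition index :: "'a \<Rightarrow> nat" where
  "index v = (THE j. j \<le> s (nat (l v)) \<and> v = x (nat (l v)) j)"

definition key :: "'a \<times> 'a \<Rightarrow> int list" where
  "key = (\<lambda>(v, w). if l v < l w then up_key (nat (l v)) (index v) (index w)
     else down_key (nat (l w)) (index v) (index w))"

lemma index_x: "i \<le> k \<Longrightarrow> j \<le> s i \<Longrightarrow> index (x i j) = j"
  unfolding index_def by (rule the_equality) (auto simp: x_in x_eq_iff)

lemma key_up: "i < k \<Longrightarrow> a \<le> s i \<Longrightarrow> b \<le> s (Suc i) \<Longrightarrow> key (x i a, x (Suc i) b) = up_key i a b"
  by (simp add: key_def x_in index_x)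

lemma key_down: "i < k \<Longrightarrow> a \<le> s i \<Longrightarrow> b \<le> s (Suc i) \<Longrightarrow> key (x (Suc i) b, x i a) = down_key i b a"
  by (simp add: key_def x_in index_x)

lemma key_step_up:
  assumes "i < k" "a \<le> s i" "b \<le> s (Suc i)"
  shows "key (x i a, x (Suc i) b) < key (step (x i a, x (Suc i) b))"
proof (cases "edge i a b")
  case True
  have step: "step (x i a, x (Suc i) b) = (x (Suc i) b, nxt (x (Suc i) b) (x i a))"
    using step_tree[OF edge_R(1)[OF True]] .
  show ?thesis
  proof (cases "a = s i")
    case a: True
    show ?thesis
    proof (cases "Suc i < k")
      case True
      have "up_key i a b < [int i, 1, - int b, 0]"
        using up_key_le_phase1[OF \<open>edge i a b\<close>] .
      also have "\<dots> < [int i, 1, - int b, 0, 0]"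
        by simp
      also have "\<dots> < up_key (Suc i) b (s (Suc (Suc i)))"
        using phase1_less_up_key[OF \<open>edge i a b\<close> True, of 0] by simp
      finally show ?thesis
        using step a nxt_down_last assms True by (simp add: key_up)
    next
      case False
      have "up_key i a b < [int i, 1, - int b, 0]"
        using up_key_le_phase1[OF \<open>edge i a b\<close>] .
      also have "\<dots> < [int i, 1, - int b, 0, 0]"
        by simp
      also have "\<dots> < down_key i b 0"
        using phase1_less_down_key[OF \<open>edge i a b\<close>, of 0] by simp
      finally show ?thesis
        using step a nxt_down_last assms False by (simp add: key_up key_down)
    qed
  next
    case False
    then show ?thesis
      using step nxt_down assms key_edge_up[OF True] by (simp add: key_up key_down)
  qed
next
  case False
  have step: "step (x i a, x (Suc i) b) = (x i a, nxt (x i a) (x (Suc i) b))"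
    using step_nontree[OF non_edge_R(1)[OF assms False]] .
  show ?thesis
  proof (cases b)
    case (Suc b')
    then show ?thesis
      using step nxt_up assms False key_up_Suc by (simp add: key_up)
  next
    case 0
    show ?thesis
    proof (cases i)
      case 0
      then show ?thesis
        using step nxt_up_first assms False \<open>b = 0\<close> key_up_0_bottom by (simp add: key_up)
    next
      case (Suc i')
      then show ?thesis
        using step nxt_up_first assms False \<open>b = 0\<close> key_up_0 by (simp add: key_up key_down)
    qed
  qed
qed

lemma key_step_down:
  assumes "i < k" "a \<le> s i" "b \<le> s (Suc i)"
    and not_basis: "step (x (Suc i) b, x i a) \<noteq> (x 0 0, x (Suc 0) (s (Suc 0)))"
  shows "key (x (Suc i) b, x i a) < key (step (x (Suc i) b, x i a))"
proof (cases "edge i a b")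
  case True
  have step: "step (x (Suc i) b, x i a) = (x i a, nxt (x i a) (x (Suc i) b))"
    using step_tree[OF edge_R(2)[OF True]] .
  show ?thesis
  proof (cases b)
    case (Suc b')
    then show ?thesis
      using step nxt_up assms True key_edge_down by (simp add: key_up key_down)
  next
    case 0
    show ?thesis
    proof (cases i)
      case 0
      then have "a \<noteq> 0"
        using step nxt_up_first[of 0 a] assms \<open>b = 0\<close> by (metis One_nat_def)
      then show ?thesis
        using step nxt_up_first assms True 0 \<open>b = 0\<close> key_edge_down_0_bottom by (simp add: key_up key_down)
    next
      case (Suc i')
      then show ?thesis
        using step nxt_up_first assms True \<open>b = 0\<close> key_edge_down_0 by (simp add: key_down)
    qed
  qed
next
  case False
  have step: "step (x (Suc i) b, x i a) = (x (Suc i) b, nxt (x (Suc i) b) (x i a))"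
    using step_nontree[OF non_edge_R(2)[OF assms(1-3) False]] .
  show ?thesis
  proof (cases "a = s i")
    case a: True
    show ?thesis
    proof (cases "Suc i < k")
      case True
      then show ?thesis
        using step a nxt_down_last assms False key_down_last_up by (simp add: key_up key_down)
    next
      case not_less: False
      then obtain a' where "edge i a' b"
        using top_edges assms by (metis Suc_lessI)
      then have "down_key i b (s i) < down_key i b 0"
        using down_key_last phase1_less_down_key assms False a by metis
      then show ?thesis
        using step a nxt_down_last assms not_less by (simp add: key_down)
    qed
  next
    case False
    then show ?thesis
      using step nxt_down assms \<open>\<not> edge i a b\<close> key_down_Suc by (simp add: key_down)
  qed
qed

lemma jaeger: "jaeger_tree G nxt (x 0 0, x (Suc 0) (s (Suc 0))) T"
  unfolding jaeger_tree_def
proof (intro conjI ballI)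
  show "is_spanning_tree G T"
    by (rule spanning)
  fix e assume e: "e \<in> parcs G - T"
  then obtain i a b where ab: "i < k" "a \<le> s i" "b \<le> s (Suc i)" "e = (x i a, x (Suc i) b)"
    using arc_iff by (metis DiffD1 surj_pair)
  then have "\<not> edge i a b"
    using e by (simp add: edge_def)
  have "key h < key (step h)" if h: "h \<in> H" "step h \<noteq> (x 0 0, x (Suc 0) (s (Suc 0)))" for h
  proof -
    obtain v w where vw: "h = (v, w)" "(v, w) \<in> parcs G \<or> (w, v) \<in> parcs G"
      using h(1) by (auto simp: neighbours_def)
    then show ?thesis
      using key_step_up key_step_down h(2) unfolding arc_iff by metis
  qed
  moreover have "key (x i a, x (Suc i) b) < key (x (Suc i) b, x i a)"
    using up_key_less_down_key[OF ab(1-3) \<open>\<not> edge i a b\<close>] ab by (simp add: key_up key_down)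
  ultimately have "time (x i a, x (Suc i) b) < time (x (Suc i) b, x i a)"
    using time_less_if_potential[of key] up_in_H[OF ab(1-3)] down_in_H[OF ab(1-3)] by blast
  then show "case e of (t, h) \<Rightarrow> precedes (tour nxt (x 0 0, x (Suc 0) (s (Suc 0))) T) (t, h) (h, t)"
    using precedes_tour_iff[OF up_in_H[OF ab(1-3)] down_in_H[OF ab(1-3)]] ab(4) by simp
qed

end

section \<open>Non-crossing comb-trees\<close>

text \<open>
  The difference of the first coordinates at height \<open>h + u\<close> is an affine function of \<open>u\<close> with
  different signs at 0 and 1, and its zero gives the common point.
\<close>

lemma open_segments_cross:
  fixes A B C D :: "real \<times> real"
  assumes "snd A = h" "snd C = h" "snd B = h + 1" "snd D = h + 1"
    and "fst A < fst C" "fst D < fst B"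
  shows "open_segment A B \<inter> open_segment C D \<noteq> {}"
proof -
  \<comment> \<open>The two segments meet at the height \<open>h + u\<close>.\<close>
  define d where "d = (fst C - fst A) + (fst B - fst D)"
  define u where "u = (fst C - fst A) / d"
  have "0 < d"
    using assms by (simp add: d_def)
  then have u: "0 < u" "u < 1" "u * d = fst C - fst A"
    using assms by (simp_all add: u_def d_def)
  define z where "z = (1 - u) *\<^sub>R A + u *\<^sub>R B"
  have "z = (1 - u) *\<^sub>R C + u *\<^sub>R D"
    using assms(1-4) u(3) by (simp add: z_def prod_eq_iff d_def algebra_simps)
  moreover have "A \<noteq> B" "C \<noteq> D"
    using assms by auto
  ultimately have "z \<in> open_segment A B" "z \<in> open_segment C D"
    using u(1,2) z_def unfolding in_segment by blast+
  then show ?thesis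
    by blast
qed

text \<open>
  A common point has the same parameter on both segments because of its height. The difference of
  the first coordinates at this parameter is a positive combination of two nonnegative numbers,
  not both 0.
\<close>

lemma open_segments_disjoint:
  fixes A B C D :: "real \<times> real"
  assumes "snd A = h" "snd C = h" "snd B = h + 1" "snd D = h + 1"
    and "fst A \<le> fst C" "fst B \<le> fst D" "fst A < fst C \<or> fst B < fst D"
  shows "open_segment A B \<inter> open_segment C D = {}"
proof (rule ccontr)
  assume "open_segment A B \<inter> open_segment C D \<noteq> {}"
  then obtain z where "z \<in> open_segment A B" "z \<in> open_segment C D"
    by blast
  then obtain u w where u: "0 < u" "u < 1"
    and eq: "(1 - u) *\<^sub>R A + u *\<^sub>R B = (1 - w) *\<^sub>R C + w *\<^sub>R D"
    unfolding in_segment by metis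
  from arg_cong[OF eq, of snd] have "u = w"
    using assms(1-4) by (simp add: algebra_simps)
  from arg_cong[OF eq, of fst] have "(1 - u) * (fst C - fst A) + u * (fst D - fst B) = 0"
    unfolding \<open>u = w\<close> by (simp add: algebra_simps)
  moreover have "0 \<le> (1 - u) * (fst C - fst A)" "0 \<le> u * (fst D - fst B)"
    using u assms by simp_all
  moreover have "0 < (1 - u) * (fst C - fst A) \<or> 0 < u * (fst D - fst B)"
    using u assms(7) by auto
  ultimately show False
    by linarith
qed

locale drawn_layered_tree = layered_tree +
  fixes pos :: "'a \<Rightarrow> real \<times> real"
  assumes drawing: "layered_drawing k s x pos"
begin

lemma segments_disjoint_iff:
  assumes "i < k" "a \<le> s i" "a' \<le> s i" "b \<le> s (Suc i)" "b' \<le> s (Suc i)" "(a, b) \<noteq> (a', b')"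
  shows "open_segment (pos (x i a)) (pos (x (Suc i) b)) \<inter>
      open_segment (pos (x i a')) (pos (x (Suc i) b')) = {} \<longleftrightarrow>
    \<not> (a < a' \<and> b' < b) \<and> \<not> (a' < a \<and> b < b')"
    (is "?S a b \<inter> ?S a' b' = {} \<longleftrightarrow> _")
proof -
  have snd: "snd (pos (x i j)) = real i" if "i \<le> k" "j \<le> s i" for i j
    using drawing that unfolding layered_drawing_def by blast
  have fst: "fst (pos (x i j)) < fst (pos (x i j'))" if "i \<le> k" "j < j'" "j' \<le> s i" for i j j'
    using drawing that unfolding layered_drawing_def by (meson less_imp_le order_trans)
  have fst_le: "fst (pos (x i j)) \<le> fst (pos (x i j'))" if "i \<le> k" "j \<le> j'" "j' \<le> s i" for i j j'
    using fst[of i j j'] that by (cases "j = j'") auto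
  have cross: "?S a b \<inter> ?S a' b' \<noteq> {}"
    if "a < a'" "b' < b" "a' \<le> s i" "b \<le> s (Suc i)" for a b a' b'
    using open_segments_cross[of _ "real i"] snd fst that assms(1) by simp
  have disjoint: "?S a b \<inter> ?S a' b' = {}"
    if "a \<le> a'" "b \<le> b'" "a' \<le> s i" "b' \<le> s (Suc i)" "(a, b) \<noteq> (a', b')" for a b a' b'
  proof (rule open_segments_disjoint[of _ "real i"])
    have "a < a' \<or> b < b'"
      using that by auto
    then show "fst (pos (x i a)) < fst (pos (x i a')) \<or> fst (pos (x (Suc i) b)) < fst (pos (x (Suc i) b'))"
      using fst that assms(1) by auto
  qed (use snd fst_le that assms(1) in auto)
  consider "a < a'" "b' < b" | "a' < a" "b < b'" | "a \<le> a'" "b \<le> b'" | "a' \<le> a" "b' \<le> b"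
    by linarith
  then show ?thesis
  proof cases
    case 1
    then show ?thesis
      using cross[of a a' b' b] assms by simp
  next
    case 2
    then show ?thesis
      using cross[of a' a b b'] assms by (auto simp: Int_commute)
  next
    case 3
    then show ?thesis
      using disjoint[of a a' b b'] assms by simp
  next
    case 4
    then show ?thesis
      using disjoint[of a' a b' b] assms by (auto simp: Int_commute)
  qed
qed

text \<open>
  A vertex of layer \<open>i\<close> off the spine lies in \<open>U i\<close> or in \<open>D i\<close>, which fixes the direction of its
  tree edges. The edge between \<open>x i 0\<close> and \<open>x (i + 1) 0\<close> is present because each of the two
  vertices has an edge in the non-crossing tree between their layers, and these edges cross unless
  one of them is the edge in question.
\<close>

lemma comb_layered_tree_if_comb:
  assumes "non_crossing_comb_tree G l k x pos T"
  shows "comb_layered_tree G l k s x T"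
proof -
  obtain D U S where
    DU: "\<And>i. i \<le> k \<Longrightarrow> D i \<union> U i = layer G l (int i) - {x i 0} \<and> D i \<inter> U i = {}"
    and T: "T = (\<Union>i\<in>{1..k}. S i)"
    and S: "\<And>i. i \<in> {1..k} \<Longrightarrow> non_crossing_tree pos ({x (i - 1) 0} \<union> U (i - 1)) ({x i 0} \<union> D i) (S i)"
    using assms unfolding non_crossing_comb_tree_def by metis
  define A where "A i = {x i 0} \<union> U i" for i
  define B where "B i = {x i 0} \<union> D i" for i
  have AB_layer: "A i \<subseteq> layer G l (int i)" "B i \<subseteq> layer G l (int i)" if "i \<le> k" for i
    using DU[OF that] layer_eq[OF that] unfolding A_def B_def by auto
  have AB_disj: "v = x i 0" if "i \<le> k" "v \<in> A i" "v \<in> B i" for i v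
    using DU[OF that(1)] that(2,3) unfolding A_def B_def by blast
  have Si: "S (Suc i) \<subseteq> A i \<times> B (Suc i)" "non_crossing pos (S (Suc i))"
    "und_tree \<lparr>pverts = A i \<union> B (Suc i), parcs = S (Suc i)\<rparr>" if "i < k" for i
    using S[of "Suc i"] that
    unfolding non_crossing_tree_def is_spanning_tree_def complete_bipartite_def A_def B_def by auto
  have edge_S: "(x i a, x (Suc i) b) \<in> S (Suc i)" if e: "edge i a b" for i a b
  proof -
    have b: "i < k" "a \<le> s i" "(x i a, x (Suc i) b) \<in> T"
      using e by (auto simp: edge_def)
    then obtain j where j: "j < k" "(x i a, x (Suc i) b) \<in> S (Suc j)"
      unfolding T by (metis UN_E Suc_le_D Suc_le_eq atLeastAtMost_iff One_nat_def)
    then have "x i a \<in> layer G l (int j)"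
      using Si(1)[OF j(1)] AB_layer(1)[of j] by auto
    then have "i = j"
      using x_in(2)[of i a] b by (simp add: layer_def)
    then show ?thesis
      using j(2) by simp
  qed
  have one_sided: "j = 0" if e: "edge i a j" "edge (Suc i) j b" for i a j b
  proof -
    have bounds: "Suc i < k" "j \<le> s (Suc i)"
      using e edge_bounds by blast+
    have "x (Suc i) j \<in> B (Suc i)" "x (Suc i) j \<in> A (Suc i)"
      using edge_S[OF e(1)] edge_S[OF e(2)] Si(1)[of i] Si(1)[of "Suc i"] bounds by auto
    then have "x (Suc i) j = x (Suc i) 0"
      using AB_disj[of "Suc i"] bounds by simp
    then show ?thesis
      using x_eq_iff[of "Suc i" j "Suc i" 0] bounds by simp
  qed
  have no_crossing: "b' \<le> b" if e: "edge i a b'" "edge i a' b" "a < a'" for i a a' b b'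
  proof -
    have bounds: "i < k" "a \<le> s i" "a' \<le> s i" "b \<le> s (Suc i)" "b' \<le> s (Suc i)"
      using e edge_bounds by blast+
    have "(x i a, x (Suc i) b') \<noteq> (x i a', x (Suc i) b)"
      using x_eq_iff[of i a i a'] bounds e(3) by simp
    then have "open_segment (pos (x i a)) (pos (x (Suc i) b')) \<inter>
        open_segment (pos (x i a')) (pos (x (Suc i) b)) = {}"
      using Si(2)[OF bounds(1)] edge_S[OF e(1)] edge_S[OF e(2)] unfolding non_crossing_def by fast
    then show ?thesis
      using segments_disjoint_iff[of i a a' b' b] bounds e(3) by auto
  qed
  have spine_edge: "edge i 0 0" if i: "i < k" for i
  proof -
    let ?R = "S (Suc i) \<union> (S (Suc i))\<inverse>"
    have S_edge: "\<exists>a b. edge i a b \<and> u = x i a \<and> w = x (Suc i) b" if uw: "(u, w) \<in> S (Suc i)" for u w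
    proof -
      have "(u, w) \<in> T"
        using uw i unfolding T by auto
      then obtain j a b where jab: "edge j a b" "u = x j a" "w = x (Suc j) b"
        by (rule T_edge)
      moreover have "u \<in> layer G l (int i)"
        using Si(1)[OF i] AB_layer(1)[of i] uw i by auto
      ultimately have "j = i"
        using x_in(2)[of j a] edge_bounds[OF jab(1)] by (simp add: layer_def)
      then show ?thesis
        using jab by blast
    qed
    have "S (Suc i) \<subseteq> (A i \<union> B (Suc i)) \<times> (A i \<union> B (Suc i))"
      using Si(1)[OF i] by blast
    then have path: "(x i 0, x (Suc i) 0) \<in> ?R\<^sup>*"
      using connected_iff_rtrancl Si(3)[OF i] unfolding und_tree_def A_def B_def by blast
    have "x i 0 \<noteq> x (Suc i) 0"
      using x_eq_iff[of i 0 "Suc i" 0] i by simp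
    from path obtain w where "(x i 0, w) \<in> ?R"
      using \<open>x i 0 \<noteq> x (Suc i) 0\<close> by (cases rule: converse_rtranclE) auto
    moreover have "(w, x i 0) \<notin> S (Suc i)"
    proof
      assume "(w, x i 0) \<in> S (Suc i)"
      then obtain a b where "edge i a b" "x i 0 = x (Suc i) b"
        using S_edge by blast
      then show False
        using x_eq_iff[of i 0 "Suc i" b] edge_bounds[of i a b] by simp
    qed
    ultimately obtain a' b where "edge i a' b" "x i 0 = x i a'"
      using S_edge by blast
    then have b: "edge i 0 b"
      using x_eq_iff[of i 0 i a'] edge_bounds[of i a' b] by simp
    from path obtain u where "(u, x (Suc i) 0) \<in> ?R"
      using \<open>x i 0 \<noteq> x (Suc i) 0\<close> by (cases rule: rtranclE) auto
    moreover have "(x (Suc i) 0, u) \<notin> S (Suc i)"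
    proof
      assume "(x (Suc i) 0, u) \<in> S (Suc i)"
      then obtain a b where "edge i a b" "x (Suc i) 0 = x i a"
        using S_edge by blast
      then show False
        using x_eq_iff[of "Suc i" 0 i a] edge_bounds[of i a b] by simp
    qed
    ultimately obtain a b' where "edge i a b'" "x (Suc i) 0 = x (Suc i) b'"
      using S_edge by blast
    then have a: "edge i a 0"
      using x_eq_iff[of "Suc i" 0 "Suc i" b'] edge_bounds[of i a b'] by simp
    show ?thesis
      using no_crossing[OF b a] a b by (cases "a = 0") auto
  qed
  show ?thesis
    by unfold_locales (fact spine_edge, fact one_sided, fact no_crossing)
qed

text \<open>
  The edges between two layers form a connected graph: a path in the tree from one of its vertices
  to the spine stays between these layers until it meets the spine, by one-sidedness, and the two
  spine vertices are adjacent.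
\<close>

lemma comb_if_comb_layered_tree:
  assumes "comb_layered_tree G l k s x T"
  shows "non_crossing_comb_tree G l k x pos T"
proof -
  interpret comb: comb_layered_tree G l k s x T
    by (rule assms)
  define U where "U i = {x i j | j b. j \<noteq> 0 \<and> edge i j b}" for i
  define D where "D i = {x i j | i' j a. j \<noteq> 0 \<and> i = Suc i' \<and> edge i' a j}" for i
  define S where "S i = {(x i' a, x i b) | i' a b. i = Suc i' \<and> edge i' a b}" for i
  have DU: "D i \<union> U i = layer G l (int i) - {x i 0} \<and> D i \<inter> U i = {}" if i: "i \<le> k" for i
  proof
    have "D i \<union> U i \<subseteq> layer G l (int i) - {x i 0}"
    proof
      fix v assume "v \<in> D i \<union> U i"
      then consider i' j a where "v = x i j" "j \<noteq> 0" "i = Suc i'" "edge i' a j"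
        | j b where "v = x i j" "j \<noteq> 0" "edge i j b"
        unfolding D_def U_def by blast
      then obtain j where "v = x i j" "j \<noteq> 0" "j \<le> s i"
        using edge_bounds by cases blast+
      then show "v \<in> layer G l (int i) - {x i 0}"
        using layer_eq[OF i] x_eq_iff[of i j i 0] i by simp
    qed
    moreover have "layer G l (int i) - {x i 0} \<subseteq> D i \<union> U i"
    proof
      fix v assume v: "v \<in> layer G l (int i) - {x i 0}"
      then obtain j where "v = x i j" "j \<le> s i" "j \<noteq> 0"
        using layer_eq[OF i] by auto
      then show "v \<in> D i \<union> U i"
        using vertex_edge[OF i, of j] unfolding D_def U_def by blast
    qed
    ultimately show "D i \<union> U i = layer G l (int i) - {x i 0}"
      by blast
    have False if v: "v \<in> D i" "v \<in> U i" for v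
    proof -
      obtain i' j a where j: "v = x i j" "j \<noteq> 0" "i = Suc i'" "edge i' a j"
        using v(1) unfolding D_def by blast
      obtain j' b where j': "v = x i j'" "edge i j' b"
        using v(2) unfolding U_def by blast
      have "j = j'"
        using j j' x_eq_iff[of i j i j'] edge_bounds[of i' a j] edge_bounds[of i j' b] by simp
      then show False
        using comb.one_sided[of i' a j b] j j' by simp
    qed
    then show "D i \<inter> U i = {}"
      by blast
  qed
  have "T = (\<Union>i\<in>{1..k}. S i)"
  proof
    show "T \<subseteq> (\<Union>i\<in>{1..k}. S i)"
    proof
      fix e assume "e \<in> T"
      then obtain i a b where "edge i a b" "e = (x i a, x (Suc i) b)"
        using T_edge by (metis surj_pair)
      then show "e \<in> (\<Union>i\<in>{1..k}. S i)"
        using edge_bounds[of i a b] unfolding S_def by (intro UN_I[of "Suc i"]) auto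
    qed
    show "(\<Union>i\<in>{1..k}. S i) \<subseteq> T"
      by (auto simp: S_def edge_def)
  qed
  moreover have "non_crossing_tree pos ({x (i - 1) 0} \<union> U (i - 1)) ({x i 0} \<union> D i) (S i)"
    if "i \<in> {1..k}" for i
  proof -
    obtain n where n: "i = Suc n" "n < k"
      using \<open>i \<in> {1..k}\<close> by (cases i) auto
    let ?A = "{x n 0} \<union> U n" and ?B = "{x (Suc n) 0} \<union> D (Suc n)" and ?S = "S (Suc n)"
    let ?R = "?S \<union> ?S\<inverse>"
    have edge_S: "(x n a, x (Suc n) b) \<in> ?S" if "edge n a b" for a b
      using that unfolding S_def by blast
    have S_AB: "?S \<subseteq> ?A \<times> ?B"
    proof
      fix e assume "e \<in> ?S"
      then obtain a b where e: "e = (x n a, x (Suc n) b)" "edge n a b"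
        unfolding S_def by blast
      have "x n a \<in> ?A"
        using e(2) unfolding U_def by (cases "a = 0") blast+
      moreover have "x (Suc n) b \<in> ?B"
        using e(2) unfolding D_def by (cases "b = 0") blast+
      ultimately show "e \<in> ?A \<times> ?B"
        using e(1) by blast
    qed
    have AB_V: "?A \<union> ?B \<subseteq> pverts G"
      using DU[of n] DU[of "Suc n"] n x_in by (auto simp: layer_def)
    have "?S \<subseteq> T"
      by (auto simp: S_def edge_def)
    have to_spine: "v \<in> ?A \<union> ?B \<longrightarrow> (v, x n 0) \<in> ?R\<^sup>*" if "(v, x n 0) \<in> R\<^sup>*" for v
      using that
    proof (induction rule: converse_rtrancl_induct)
      case base
      then show ?case
        by simp
    next
      case (step v w)
      show ?case
      proof
        assume "v \<in> ?A \<union> ?B"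
        then consider "v = x n 0" | "v = x (Suc n) 0" | j b where "v = x n j" "j \<noteq> 0" "edge n j b"
          | j a where "v = x (Suc n) j" "j \<noteq> 0" "edge n a j"
          unfolding U_def D_def by blast
        then show "(v, x n 0) \<in> ?R\<^sup>*"
        proof cases
          case 1
          then show ?thesis
            by simp
        next
          case 2
          then show ?thesis
            using edge_S[OF comb.spine_edge[OF n(2)]] by blast
        next
          case 3
          then have "n \<le> k" "j \<le> s n" "(w, x n j) \<in> R"
            using edge_bounds[OF 3(3)] R_sym[OF step.hyps(1)] by auto
          then obtain c where "edge n j c" "w = x (Suc n) c"
          proof (cases rule: R_edge)
            case (down i' c)
            then show ?thesis
              using comb.one_sided[of i' c j b] 3 by simp
          qed
          then have "(w, v) \<in> ?R" "(v, w) \<in> ?R"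
            using edge_S 3(1) by blast+
          then show ?thesis
            using step.IH S_AB by (blast intro: converse_rtrancl_into_rtrancl)
        next
          case 4
          then have "Suc n \<le> k" "j \<le> s (Suc n)" "(w, x (Suc n) j) \<in> R"
            using edge_bounds[OF 4(3)] R_sym[OF step.hyps(1)] by auto
          then obtain c where "edge n c j" "w = x n c"
          proof (cases rule: R_edge)
            case (up c)
            then show ?thesis
              using comb.one_sided[OF 4(3) up(1)] 4(2) by simp
          next
            case (down i' c)
            then show ?thesis
              using that by simp
          qed
          then have "(w, v) \<in> ?R" "(v, w) \<in> ?R"
            using edge_S 4(1) by blast+
          then show ?thesis
            using step.IH S_AB by (blast intro: converse_rtrancl_into_rtrancl)
        qed
      qed
    qed
    have to_spine': "(v, x n 0) \<in> ?R\<^sup>*" if "v \<in> ?A \<union> ?B" for v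
      using to_spine T_connected[of v "x n 0"] AB_V that by blast
    have "sym ?R"
      by (auto simp: sym_def)
    have "(u, v) \<in> ?R\<^sup>*" if "u \<in> ?A \<union> ?B" "v \<in> ?A \<union> ?B" for u v
      using to_spine'[OF that(1)] symD[OF sym_rtrancl[OF \<open>sym ?R\<close>] to_spine'[OF that(2)]]
      by (rule rtrancl_trans)
    then have "Digraph_Component.connected (with_proj \<lparr>pverts = ?A \<union> ?B, parcs = ?S\<rparr>)"
      using connected_iff_rtrancl[of ?S "?A \<union> ?B"] S_AB by blast
    moreover have "\<not> und_cycle \<lparr>pverts = ?A \<union> ?B, parcs = ?S\<rparr> p" for p
      using und_cycle_mono[OF _ AB_V \<open>?S \<subseteq> T\<close>] spanning
      unfolding is_spanning_tree_def und_tree_def by blast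
    ultimately have "is_spanning_tree (complete_bipartite ?A ?B) ?S"
      using S_AB unfolding is_spanning_tree_def und_tree_def complete_bipartite_def by simp
    moreover have "non_crossing pos ?S"
    proof -
      have "open_segment (pos (x n a)) (pos (x (Suc n) b)) \<inter>
          open_segment (pos (x n a')) (pos (x (Suc n) b')) = {}"
        if "edge n a b" "edge n a' b'" "(a, b) \<noteq> (a', b')" for a b a' b'
        using segments_disjoint_iff[of n a a' b b'] that edge_bounds comb.no_crossing
        by (meson not_le)
      then show ?thesis
        unfolding non_crossing_def S_def by fastforce
    qed
    ultimately show ?thesis
      unfolding non_crossing_tree_def n by simp
  qed
  moreover have "D 0 = {}" "U k = {}"
    using edge_bounds unfolding D_def U_def by auto
  ultimately show ?thesis
    using DU spanning unfolding non_crossing_comb_tree_def by blast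
qed

end

theorem proposition9p3:
  fixes G :: "'a pair_pre_digraph"
    and l :: "'a \<Rightarrow> int"
    and k :: nat
    and s :: "nat \<Rightarrow> nat"
    and x :: "nat \<Rightarrow> nat \<Rightarrow> 'a"
    and pos :: "'a \<Rightarrow> real \<times> real"
  assumes "layer_complete G l"
    and "1 \<le> k"
    and "\<forall>i. layer G l i \<noteq> {} \<longleftrightarrow> 0 \<le> i \<and> i \<le> int k"
    and "layer_enumeration G l k s x"
    and "layered_drawing k s x pos"
  shows "{T. jaeger_tree G (plane_ribbon l k s x) (x 0 0, x 1 (s 1)) T} =
         {T. non_crossing_comb_tree G l k x pos T}"
proof -
  have graph: "complete_layers G l k s x"
    using assms by unfold_locales auto
  have "jaeger_tree G (plane_ribbon l k s x) (x 0 0, x 1 (s 1)) T \<longleftrightarrow>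
      non_crossing_comb_tree G l k x pos T" for T
  proof (cases "is_spanning_tree G T")
    case True
    interpret drawn_layered_tree G l k s x T pos
      using graph True assms(5)
      by (simp add: drawn_layered_tree_def drawn_layered_tree_axioms_def layered_tree_def layered_tree_axioms_def)
    have "comb_layered_tree G l k s x T"
      if "jaeger_tree G (plane_ribbon l k s x) (x 0 0, x 1 (s 1)) T"
    proof -
      interpret jaeger_layered_tree G l k s x T
        using that by unfold_locales simp
      show ?thesis
        by unfold_locales (fact spine_edge, fact one_sided, fact no_crossing)
    qed
    moreover have "jaeger_tree G (plane_ribbon l k s x) (x 0 0, x 1 (s 1)) T"
      if "comb_layered_tree G l k s x T"
      using comb_layered_tree.jaeger[OF that] by simp
    ultimately show ?thesis
      using comb_layered_tree_if_comb comb_if_comb_layered_tree by blast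
  next
    case False
    then show ?thesis
      by (simp add: jaeger_tree_def non_crossing_comb_tree_def)
  qed
  then show ?thesis
    by simp
qed

end
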